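(* Let $\ell\ge 2$. Suppose that $\lambda$ is an $\ell$-partition and $0\le i<\ell$. Write $\varphi=\varphi_i(\lambda)$ and $\varepsilon=\varepsilon_i(\lambda)$. Then 1. $\widetilde f_i^{\,\varphi}\lambda$ is an $\ell$-partition; 2. $\widetilde e_i^{\,\varepsilon}\lambda$ is an $\ell$-partition.
   Context: A partition is $\ell$-regular if it does not have $\ell$ or more equal nonzero parts. A removable $\ell$-rim hook (for short, $\ell$-rim hook) of $\lambda$ is a connected sequence of $\ell$ boxes of the Young diagram of $\lambda$, containing no $2\times2$ square, whose removal from $\lambda$ leaves the Young diagram of a partition. It is horizontal if all its boxes lie in one row, and non-horizontal otherwise. An $\ell$-partition is an $\ell$-regular partition which has no non-horizontal $\ell$-rim hooks and such that, after removing any number of horizontal $\ell$-rim hooks in any order, the remaining diagram has no non-horizontal $\ell$-rim hooks. Crystal $B(\Lambda_0)$ of $\widehat{\mathfrak{sl}_\ell}$ (nodes: the $\ell$-regular partitions). The position in row $a$, column $b$ has residue $b-a \bmod \ell$. A box $x$ of $\lambda$ is a removable $i$-box if it has residue $i$ and $\lambda\setminus x$ is a partition; a position $y\notin\lambda$ is an addable $i$-box if it has residue $i$ and $\lambda\cup y$ is a partition. Put $-$ in each removable $i$-box and $+$ in each addable $i$-box. The $i$-signature of $\lambda$ is the word of $+$'s and $-$'s read from bottom left to top right; the reduced $i$-signature is obtained by repeatedly deleting adjacent pairs $-+$, giving a word $+\cdots+-\cdots-$. Boxes of the remaining $-$'s are the normal $i$-boxes and boxes of the remaining $+$'s are the conormal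 $i$-boxes; $\varepsilon_i(\lambda)$ and $\varphi_i(\lambda)$ are their respective numbers. The good $i$-box is the one of the leftmost remaining $-$; the cogood $i$-box is the one of the rightmost remaining $+$. $\widetilde e_i\lambda$ is $\lambda$ with its good $i$-box removed (or $0$ if there is none), and $\widetilde f_i\lambda$ is $\lambda$ with its cogood $i$-box added (or $0$ if there is none). *)

theory Defs
  imports Main
begin

section \<open>Partitions as Young diagrams\<close>

text \<open>
  A partition is identified with its Young diagram, in English notation with matrix
  coordinates: the box \<open>(a, b)\<close> lies in row \<open>a \<ge> 1\<close> (counted from the top) and in column
  \<open>b \<ge> 1\<close> (counted from the left).
\<close>

type_synonym box = "nat \<times> nat"

definition young_diagram :: "box set \<Rightarrow> bool" where
  "young_diagram D \<longleftrightarrow> finite D \<and>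
     (\<forall>(a, b) \<in> D. 1 \<le> a \<and> 1 \<le> b \<and>
        (\<forall>a' b'. 1 \<le> a' \<and> a' \<le> a \<and> 1 \<le> b' \<and> b' \<le> b \<longrightarrow> (a', b') \<in> D))"

lemma young_diagramD:
  assumes "young_diagram D" "(a, b) \<in> D" "1 \<le> a'" "a' \<le> a" "1 \<le> b'" "b' \<le> b"
  shows "(a', b') \<in> D"
  using assms unfolding young_diagram_def by blast

lemma young_diagram_pos:
  assumes "young_diagram D" "(a, b) \<in> D"
  shows "1 \<le> a" "1 \<le> b"
  using assms unfolding young_diagram_def by blast+

text \<open>The parts \<open>\<lambda>\<^sub>1 \<ge> \<lambda>\<^sub>2 \<ge> \<dots>\<close> of the partition are the row lengths of its diagram.\<close>

definition part :: "box set \<Rightarrow> nat \<Rightarrow> nat" where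
  "part D a = card {b. (a, b) \<in> D}"

lemma young_diagram_row:
  assumes "young_diagram D" "1 \<le> a"
  shows "{b. (a, b) \<in> D} = {1..part D a}"
proof -
  let ?R = "{b. (a, b) \<in> D}"
  have fin: "finite ?R"
    using assms(1) finite_subset[of ?R "snd ` D"] by (force simp: young_diagram_def)
  show ?thesis
  proof (cases "?R = {}")
    case True
    then show ?thesis by (simp add: part_def)
  next
    case False
    then have mx: "Max ?R \<in> ?R" using fin by (intro Max_in)
    have "?R = {1..Max ?R}"
    proof (rule set_eqI, rule iffI)
      fix b assume b: "b \<in> ?R"
      then have "1 \<le> b" using assms(1) by (auto simp: young_diagram_def)
      then show "b \<in> {1..Max ?R}" using b fin by simp
    next
      fix b assume "b \<in> {1..Max ?R}"
      then show "b \<in> ?R" using mx young_diagramD[OF assms(1), of a "Max ?R" a b] assms(2) by auto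
    qed
    then show ?thesis unfolding part_def by (metis card_atLeastAtMost diff_Suc_1)
  qed
qed

text \<open>
  The diagrams are exactly the sets \<open>{(a, b). 1 \<le> a \<and> 1 \<le> b \<le> p a}\<close> for a weakly decreasing
  sequence \<open>p 1 \<ge> p 2 \<ge> \<dots>\<close> of natural numbers that is eventually zero; the sequence is \<open>part D\<close>.
\<close>

lemma young_diagram_iff_parts:
  "young_diagram D \<longleftrightarrow>
     (\<exists>p :: nat \<Rightarrow> nat. (\<forall>a a'. 1 \<le> a \<and> a \<le> a' \<longrightarrow> p a' \<le> p a) \<and> finite {a. 1 \<le> a \<and> p a \<noteq> 0} \<and>
        D = {(a, b). 1 \<le> a \<and> 1 \<le> b \<and> b \<le> p a} \<and> (\<forall>a\<ge>1. part D a = p a))"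
proof
  assume D: "young_diagram D"
  have mem: "(a, b) \<in> D \<longleftrightarrow> 1 \<le> b \<and> b \<le> part D a" if "1 \<le> a" for a b
    using young_diagram_row[OF D that] by auto
  have pos: "1 \<le> a" if "(a, b) \<in> D" for a b
    using D that by (auto simp: young_diagram_def)
  have "part D a' \<le> part D a" if "1 \<le> a" "a \<le> a'" for a a'
  proof (cases "part D a' = 0")
    case False
    then have "(a', part D a') \<in> D" using mem[of a'] that by simp
    then have "(a, part D a') \<in> D"
      using young_diagramD[OF D, of a' "part D a'" a "part D a'"] that False by simp
    then show ?thesis using mem that by simp
  qed simp
  moreover have "{a. 1 \<le> a \<and> part D a \<noteq> 0} \<subseteq> fst ` D"
  proof
    fix a assume "a \<in> {a. 1 \<le> a \<and> part D a \<noteq> 0}"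
    then have "(a, 1) \<in> D" using mem[of a 1] by simp
    then show "a \<in> fst ` D" by force
  qed
  then have "finite {a. 1 \<le> a \<and> part D a \<noteq> 0}"
    using D finite_subset by (auto simp: young_diagram_def)
  moreover have "D = {(a, b). 1 \<le> a \<and> 1 \<le> b \<and> b \<le> part D a}"
    using mem pos by blast
  ultimately show "\<exists>p :: nat \<Rightarrow> nat. (\<forall>a a'. 1 \<le> a \<and> a \<le> a' \<longrightarrow> p a' \<le> p a) \<and>
      finite {a. 1 \<le> a \<and> p a \<noteq> 0} \<and>
      D = {(a, b). 1 \<le> a \<and> 1 \<le> b \<and> b \<le> p a} \<and> (\<forall>a\<ge>1. part D a = p a)"
    by blast
next
  assume "\<exists>p :: nat \<Rightarrow> nat. (\<forall>a a'. 1 \<le> a \<and> a \<le> a' \<longrightarrow> p a' \<le> p a) \<and>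
      finite {a. 1 \<le> a \<and> p a \<noteq> 0} \<and>
      D = {(a, b). 1 \<le> a \<and> 1 \<le> b \<and> b \<le> p a} \<and> (\<forall>a\<ge>1. part D a = p a)"
  then obtain p :: "nat \<Rightarrow> nat" where
    mono: "\<And>a a'. 1 \<le> a \<Longrightarrow> a \<le> a' \<Longrightarrow> p a' \<le> p a" and
    fin: "finite {a. 1 \<le> a \<and> p a \<noteq> 0}" and
    D: "D = {(a, b). 1 \<le> a \<and> 1 \<le> b \<and> b \<le> p a}"
    by blast
  have "D \<subseteq> (SIGMA a:{a. 1 \<le> a \<and> p a \<noteq> 0}. {..p a})" using D by auto
  then have "finite D" using fin by (meson finite_SigmaI finite_atMost finite_subset)
  then show "young_diagram D"
    unfolding young_diagram_def using D by (auto intro: order_trans[OF _ mono] order_trans)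
qed

definition l_regular :: "nat \<Rightarrow> box set \<Rightarrow> bool" where
  "l_regular l D \<longleftrightarrow> \<not> (\<exists>k>0. card {a. part D a = k} \<ge> l)"

section \<open>Rim hooks and \<open>\<ell>\<close>-partitions\<close>

text \<open>Two boxes are adjacent if they share an edge.\<close>

definition adjacent :: "box \<Rightarrow> box \<Rightarrow> bool" where
  "adjacent x y \<longleftrightarrow>
     (fst x = fst y \<and> (snd y = Suc (snd x) \<or> snd x = Suc (snd y))) \<or>
     (snd x = snd y \<and> (fst y = Suc (fst x) \<or> fst x = Suc (fst y)))"

definition box_connected :: "box set \<Rightarrow> bool" where
  "box_connected R \<longleftrightarrow>
     (\<forall>x\<in>R. \<forall>y\<in>R. (\<lambda>u v. u \<in> R \<and> v \<in> R \<and> adjacent u v)\<^sup>*\<^sup>* x y)"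

text \<open>Here \<open>rim_hook l D R\<close> says that \<open>R\<close> is a removable \<open>l\<close>-rim hook of \<open>D\<close>.\<close>

definition rim_hook :: "nat \<Rightarrow> box set \<Rightarrow> box set \<Rightarrow> bool" where
  "rim_hook l D R \<longleftrightarrow>
     R \<subseteq> D \<and> card R = l \<and> box_connected R \<and>
     \<not> (\<exists>a b. {(a, b), (a, Suc b), (Suc a, b), (Suc a, Suc b)} \<subseteq> R) \<and>
     young_diagram (D - R)"

definition horizontal :: "box set \<Rightarrow> bool" where
  "horizontal R \<longleftrightarrow> (\<exists>a. \<forall>x\<in>R. fst x = a)"

definition remove_horizontal_hook :: "nat \<Rightarrow> box set \<Rightarrow> box set \<Rightarrow> bool" where
  "remove_horizontal_hook l D E \<longleftrightarrow> (\<exists>R. rim_hook l D R \<and> horizontal R \<and> E = D - R)"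

text \<open>
  Zero removals are included in the closure, so the last clause also says that \<open>D\<close> itself
  has no non-horizontal rim hooks.
\<close>

definition l_partition :: "nat \<Rightarrow> box set \<Rightarrow> bool" where
  "l_partition l D \<longleftrightarrow>
     young_diagram D \<and> l_regular l D \<and>
     (\<forall>E. (remove_horizontal_hook l)\<^sup>*\<^sup>* D E \<longrightarrow> \<not> (\<exists>R. rim_hook l E R \<and> \<not> horizontal R))"

section \<open>Signatures\<close>

definition content :: "box \<Rightarrow> int" where
  "content x = int (snd x) - int (fst x)"

definition residue :: "nat \<Rightarrow> box \<Rightarrow> int" where
  "residue l x = content x mod int l"

definition removable :: "nat \<Rightarrow> int \<Rightarrow> box set \<Rightarrow> box \<Rightarrow> bool" where
  "removable l i D x \<longleftrightarrow> x \<in> D \<and> residue l x = i \<and> young_diagram (D - {x})"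

definition addable :: "nat \<Rightarrow> int \<Rightarrow> box set \<Rightarrow> box \<Rightarrow> bool" where
  "addable l i D y \<longleftrightarrow> y \<notin> D \<and> residue l y = i \<and> young_diagram (insert y D)"

datatype sign = Plus | Minus

text \<open>
  Each sign carries its box along, so that cancelling signs keeps track of the surviving boxes.
  Addable and removable boxes lie on the border of the diagram, along which the content
  strictly increases from bottom left to top right (see \<open>signature_boxes_order\<close> below);
  sorting by content therefore reads the signs in the required order.
\<close>

definition signature_boxes :: "nat \<Rightarrow> int \<Rightarrow> box set \<Rightarrow> box set" where
  "signature_boxes l i D = {x. removable l i D x \<or> addable l i D x}"

definition signature :: "nat \<Rightarrow> int \<Rightarrow> box set \<Rightarrow> (sign \<times> box) list" where
  "signature l i D =
     map (\<lambda>x. (if removable l i D x then Minus else Plus, x))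
       (sorted_key_list_of_set content (signature_boxes l i D))"

lemma corner_order:
  assumes D: "young_diagram D"
    and x: "x \<in> D \<and> young_diagram (D - {x}) \<or> x \<notin> D \<and> young_diagram (insert x D)"
    and y: "y \<in> D \<and> young_diagram (D - {y}) \<or> y \<notin> D \<and> young_diagram (insert y D)"
    and less: "fst y < fst x"
  shows "snd x \<le> snd y"
proof (rule ccontr)
  assume "\<not> snd x \<le> snd y"
  obtain a b c d where xy: "x = (a, b)" "y = (c, d)" by fastforce
  have lt: "c < a" "d < b" using less \<open>\<not> snd x \<le> snd y\<close> xy by auto
  have I: "young_diagram (insert x D)" using x D by (auto simp: insert_absorb)
  have J: "young_diagram (insert y D)" using y D by (auto simp: insert_absorb)
  have cd: "1 \<le> c" "1 \<le> d" using young_diagram_pos[OF J, of c d] xy by auto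
  have "(a, b) \<in> insert x D" using xy by simp
  then have "(c, d) \<in> insert x D" "(Suc c, d) \<in> insert x D"
    using young_diagramD[OF I] lt cd by auto
  then have "(c, d) \<in> D" and S: "(Suc c, d) \<in> D - {y}" using xy lt by auto
  then have "young_diagram (D - {y})" using y xy by auto
  from young_diagramD[OF this S, of c d] show False using xy cd by auto
qed

lemma signature_boxes_order:
  assumes "young_diagram D" "x \<in> signature_boxes l i D" "y \<in> signature_boxes l i D"
    and "content x < content y"
  shows "fst y \<le> fst x" "snd x \<le> snd y"
proof -
  have x: "x \<in> D \<and> young_diagram (D - {x}) \<or> x \<notin> D \<and> young_diagram (insert x D)"
    and y: "y \<in> D \<and> young_diagram (D - {y}) \<or> y \<notin> D \<and> young_diagram (insert y D)"
    using assms(2,3) by (auto simp: signature_boxes_def removable_def addable_def)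
  show "fst y \<le> fst x"
    using corner_order[OF assms(1) y x] assms(4) by (force simp: content_def)
  then show "snd x \<le> snd y"
    using corner_order[OF assms(1) x y] assms(4) by (force simp: content_def)
qed

lemma inj_on_content_signature_boxes:
  assumes "young_diagram D"
  shows "inj_on content (signature_boxes l i D)"
proof (rule inj_onI)
  fix x y
  assume *: "x \<in> signature_boxes l i D" "y \<in> signature_boxes l i D" "content x = content y"
  then have x: "x \<in> D \<and> young_diagram (D - {x}) \<or> x \<notin> D \<and> young_diagram (insert x D)"
    and y: "y \<in> D \<and> young_diagram (D - {y}) \<or> y \<notin> D \<and> young_diagram (insert y D)"
    by (auto simp: signature_boxes_def removable_def addable_def)
  have "\<not> fst y < fst x"
    using corner_order[OF assms x y] *(3) by (auto simp: content_def)
  moreover have "\<not> fst x < fst y"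
    using corner_order[OF assms y x] *(3) by (auto simp: content_def)
  ultimately show "x = y" using *(3) by (auto simp: content_def prod_eq_iff)
qed

lemma finite_signature_boxes:
  assumes "young_diagram D"
  shows "finite (signature_boxes l i D)"
proof -
  obtain N where N: "\<And>a b. (a, b) \<in> D \<Longrightarrow> a \<le> N \<and> b \<le> N"
  proof -
    have "finite (fst ` D \<union> snd ` D)" using assms by (auto simp: young_diagram_def)
    then obtain N where "\<forall>n\<in>fst ` D \<union> snd ` D. n \<le> N"
      using finite_nat_set_iff_bounded_le by blast
    then show thesis by (intro that[of N]) force
  qed
  have "a \<le> Suc N \<and> b \<le> Suc N" if "(a, b) \<in> signature_boxes l i D" for a b
  proof (cases "(a, b) \<in> D")
    case True
    then show ?thesis using N by fastforce
  next
    case False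
    then have I: "young_diagram (insert (a, b) D)"
      using that by (auto simp: signature_boxes_def removable_def addable_def)
    have ab: "(a, b) \<in> insert (a, b) D" "1 \<le> a" "1 \<le> b"
      using young_diagram_pos[OF I, of a b] by auto
    show ?thesis
    proof (rule conjI; rule ccontr)
      assume "\<not> a \<le> Suc N"
      then have "(Suc N, b) \<in> D" using young_diagramD[OF I ab(1), of "Suc N" b] ab by auto
      then show False using N by fastforce
    next
      assume "\<not> b \<le> Suc N"
      then have "(a, Suc N) \<in> D" using young_diagramD[OF I ab(1), of a "Suc N"] ab by auto
      then show False using N by fastforce
    qed
  qed
  then have "signature_boxes l i D \<subseteq> {..Suc N} \<times> {..Suc N}" by auto
  then show ?thesis by (meson finite_SigmaI finite_atMost finite_subset)
qed

lemma (in linorder) sorted_key_list_of_set_inj_on: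
  assumes "finite S" "inj_on f S"
  shows "set (sorted_key_list_of_set f S) = S" (is ?set)
    and "sorted_wrt (<) (map f (sorted_key_list_of_set f S))" (is ?sorted)
proof -
  interpret folding_insort_key "(\<le>)" "(<)" S f
    by unfold_locales (rule assms(2))
  show ?set ?sorted using assms(1) by simp_all
qed

lemma signature_boxes_list:
  fixes l :: nat and i :: int
  assumes "young_diagram D"
  defines "xs \<equiv> sorted_key_list_of_set content (signature_boxes l i D)"
  shows "set xs = signature_boxes l i D" and "sorted_wrt (<) (map content xs)"
  unfolding xs_def
  by (intro sorted_key_list_of_set_inj_on finite_signature_boxes
      inj_on_content_signature_boxes assms(1))+

text \<open>One step of the reduction: delete an adjacent pair \<open>-+\<close>.\<close>

inductive cancel :: "(sign \<times> 'b) list \<Rightarrow> (sign \<times> 'b) list \<Rightarrow> bool" where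
  "cancel (u @ (Minus, x) # (Plus, y) # v) (u @ v)"

definition reduced_signature :: "nat \<Rightarrow> int \<Rightarrow> box set \<Rightarrow> (sign \<times> box) list" where
  "reduced_signature l i D =
     (THE w. cancel\<^sup>*\<^sup>* (signature l i D) w \<and> \<not> (\<exists>w'. cancel w w'))"

text \<open>
  The order of the deletions does not matter, so the description above is well defined.
  The function \<open>reduce\<close> computes the result.
\<close>

fun push :: "(sign \<times> 'b) \<Rightarrow> (sign \<times> 'b) list \<Rightarrow> (sign \<times> 'b) list" where
  "push (Minus, x) ((Plus, y) # w) = w"
| "push p w = p # w"

definition reduce :: "(sign \<times> 'b) list \<Rightarrow> (sign \<times> 'b) list" where
  "reduce w = foldr push w []"

lemma cancel_Cons: "cancel v w \<Longrightarrow> cancel (p # v) (p # w)"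
  by (metis append_Cons cancel.simps)

lemma cancel_rtranclp_Cons: "cancel\<^sup>*\<^sup>* v w \<Longrightarrow> cancel\<^sup>*\<^sup>* (p # v) (p # w)"
  by (induction rule: rtranclp_induct) (auto intro: cancel_Cons rtranclp.rtrancl_into_rtrancl)

lemma cancel_push: "cancel\<^sup>*\<^sup>* (p # w) (push p w)"
proof (cases "(p, w)" rule: push.cases)
  case (1 x y v)
  then show ?thesis using cancel.intros[of "[]" x y v] by auto
qed auto

lemma cancel_reduce: "cancel\<^sup>*\<^sup>* w (reduce w)"
proof (induction w)
  case (Cons p w)
  then show ?case
    unfolding reduce_def using cancel_rtranclp_Cons cancel_push by (metis (no_types) foldr_Cons o_apply rtranclp_trans)
qed (simp add: reduce_def)

lemma reduce_cancel: "cancel v w \<Longrightarrow> reduce v = reduce w"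
  by (induction rule: cancel.induct) (simp add: reduce_def)

lemma reduce_irreducible:
  "\<not> (\<exists>w'. cancel w w') \<Longrightarrow> reduce w = w"
proof (induction w)
  case (Cons p w)
  then have "reduce w = w" using cancel_Cons by blast
  moreover have "push p w = p # w"
    using Cons.prems cancel.intros[of "[]", simplified]
    by (cases "(p, w)" rule: push.cases) (fastforce simp del: not_ex)+
  ultimately show ?case by (simp add: reduce_def)
qed (simp add: reduce_def)

lemma reduce_form:
  "\<exists>xs ys. reduce w = map (Pair Plus) xs @ map (Pair Minus) ys"
proof (induction w)
  case (Cons p w)
  then obtain xs ys where w: "reduce w = map (Pair Plus) xs @ map (Pair Minus) ys" by blast
  obtain s x where p: "p = (s, x)" by fastforce
  have r: "reduce (p # w) = push p (reduce w)" by (simp add: reduce_def)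
  show ?case
  proof (cases s)
    case Plus
    then have "reduce (p # w) = map (Pair Plus) (x # xs) @ map (Pair Minus) ys"
      using r p w by simp
    then show ?thesis by blast
  next
    case Minus
    show ?thesis
    proof (cases xs)
      case Nil
      have "reduce (p # w) = map (Pair Plus) [] @ map (Pair Minus) (x # ys)"
        using r p w Minus Nil by (cases ys) simp_all
      then show ?thesis by blast
    next
      case (Cons z zs)
      then have "reduce (p # w) = map (Pair Plus) zs @ map (Pair Minus) ys"
        using r p w Minus by simp
      then show ?thesis by blast
    qed
  qed
qed (simp add: reduce_def)

lemma not_cancel_form: "\<not> cancel (map (Pair Plus) xs @ map (Pair Minus) ys) w"
proof
  assume "cancel (map (Pair Plus) xs @ map (Pair Minus) ys) w"
  then obtain u x y v where
    e: "map (Pair Plus) xs @ map (Pair Minus) ys = u @ (Minus, x) # (Plus, y) # v"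
    by (auto elim: cancel.cases)
  let ?w = "map (Pair Plus) xs @ map (Pair Minus) ys"
  let ?n = "length u"
  have n: "fst (?w ! ?n) = Minus" "fst (?w ! Suc ?n) = Plus" "Suc ?n < length ?w"
    unfolding e by (simp_all add: nth_append)
  then show False
    by (cases "?n < length xs"; cases "Suc ?n < length xs") (auto simp: nth_append)
qed

lemma reduce_unique:
  "cancel\<^sup>*\<^sup>* v w \<and> \<not> (\<exists>w'. cancel w w') \<longleftrightarrow> w = reduce v"
proof
  assume *: "cancel\<^sup>*\<^sup>* v w \<and> \<not> (\<exists>w'. cancel w w')"
  then have "cancel\<^sup>*\<^sup>* v w" by blast
  then have "reduce v = reduce w"
    by (induction rule: rtranclp_induct) (auto dest: reduce_cancel)
  then show "w = reduce v" using reduce_irreducible * by metis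
next
  assume "w = reduce v"
  then show "cancel\<^sup>*\<^sup>* v w \<and> \<not> (\<exists>w'. cancel w w')"
    using cancel_reduce reduce_form[of v] not_cancel_form by metis
qed

lemma reduced_signature_eq: "reduced_signature l i D = reduce (signature l i D)"
  unfolding reduced_signature_def reduce_unique by simp

section \<open>Crystal operators\<close>

text \<open>Both lists of boxes are in the order of the reduced signature, from left to right.\<close>

definition normal_boxes :: "nat \<Rightarrow> int \<Rightarrow> box set \<Rightarrow> box list" where
  "normal_boxes l i D = map snd (filter (\<lambda>p. fst p = Minus) (reduced_signature l i D))"

definition conormal_boxes :: "nat \<Rightarrow> int \<Rightarrow> box set \<Rightarrow> box list" where
  "conormal_boxes l i D = map snd (filter (\<lambda>p. fst p = Plus) (reduced_signature l i D))"

definition epsilon :: "nat \<Rightarrow> int \<Rightarrow> box set \<Rightarrow> nat" where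
  "epsilon l i D = length (normal_boxes l i D)"

definition phi :: "nat \<Rightarrow> int \<Rightarrow> box set \<Rightarrow> nat" where
  "phi l i D = length (conormal_boxes l i D)"

text \<open>
  The crystal operators act on \<open>box set option\<close>, where \<open>None\<close> is the element \<open>0\<close> adjoined to
  the crystal (not the empty partition, which is \<open>Some {}\<close>); they send \<open>0\<close> to \<open>0\<close>.
\<close>

fun e_tilde :: "nat \<Rightarrow> int \<Rightarrow> box set option \<Rightarrow> box set option" where
  "e_tilde l i None = None"
| "e_tilde l i (Some D) =
     (if normal_boxes l i D = [] then None else Some (D - {hd (normal_boxes l i D)}))"

fun f_tilde :: "nat \<Rightarrow> int \<Rightarrow> box set option \<Rightarrow> box set option" where
  "f_tilde l i None = None"
| "f_tilde l i (Some D) =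
     (if conormal_boxes l i D = [] then None else Some (insert (last (conormal_boxes l i D)) D))"

end

theory Submission
  imports Defs
begin

text \<open>
  Encode a partition by its set of beads \<open>\<lambda>\<^sub>a - a\<close>. Removing an \<open>l\<close>-rim hook moves a bead \<open>x\<close> to a
  gap \<open>x - l\<close>, and the hook is horizontal iff no bead lies strictly between. This shows that the
  \<open>l\<close>-partitions are the partitions with the following property: if some bead above a gap \<open>y\<close> is
  congruent to \<open>y\<close> modulo \<open>l\<close>, then all beads above \<open>y\<close> are.

  An addable \<open>i\<close>-box of content \<open>c\<close> is a bead \<open>c - 1\<close> followed by a gap \<open>c\<close>, a removable one a gap
  \<open>c - 1\<close> followed by a bead \<open>c\<close>. For an \<open>l\<close>-partition no \<open>-\<close> precedes a \<open>+\<close>, so nothing cancels in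
  the \<open>i\<close>-signature, and the maximal powers of the crystal operators add all addable, respectively
  remove all removable, \<open>i\<close>-boxes. The bead condition visibly survives this simultaneous exchange
  on the runners \<open>i - 1\<close> and \<open>i\<close>.
\<close>

section \<open>Rim hooks as bead moves\<close>

text \<open>This is the content of the last box of row \<open>a\<close>. Empty rows contribute
  \<open>- a\<close>, so \<open>beads D\<close> contains every sufficiently small integer.\<close>

definition bead :: "box set \<Rightarrow> nat \<Rightarrow> int" where
  "bead D a = int (part D a) - int a"

definition beads :: "box set \<Rightarrow> int set" where
  "beads D = bead D ` {1..}"

lemma bead_less:
  assumes "young_diagram D" "1 \<le> a" "a < a'"
  shows "bead D a' < bead D a"
proof -
  obtain p where p: "\<And>a a'. 1 \<le> a \<and> a \<le> a' \<Longrightarrow> p a' \<le> p a" "\<And>a. 1 \<le> a \<Longrightarrow> part D a = p a"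
    using assms(1) young_diagram_iff_parts[of D] by blast
  have "part D a' \<le> part D a" using p(1)[of a a'] p(2)[of a] p(2)[of a'] assms by simp
  then show ?thesis using assms by (simp add: bead_def)
qed

lemma bead_less_iff:
  assumes "young_diagram D" "1 \<le> a" "1 \<le> a'"
  shows "bead D a' < bead D a \<longleftrightarrow> a < a'"
  using bead_less[OF assms(1,2), of a'] bead_less[OF assms(1,3), of a]
  by (metis less_asym linorder_neqE_nat order_less_irrefl)

lemma inj_on_bead: "young_diagram D \<Longrightarrow> inj_on (bead D) {1..}"
  by (intro inj_onI) (metis atLeast_iff bead_less linorder_neqE_nat order_less_irrefl)

lemma box_iff_le_bead:
  assumes "young_diagram D" "1 \<le> a"
  shows "(a, b) \<in> D \<longleftrightarrow> 1 \<le> b \<and> int b - int a \<le> bead D a"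
  using eqset_imp_iff[OF young_diagram_row[OF assms], of b] by (simp add: bead_def)

text \<open>Row \<open>a\<close> meets the diagonal of content \<open>c\<close> in column
  \<open>int a + c\<close>; the first disjunct is the case where that column lies left of the
  diagram.\<close>

lemma le_bead_iff:
  assumes "young_diagram D" "1 \<le> a"
  shows "c \<le> bead D a \<longleftrightarrow> int a + c \<le> 0 \<or> (a, nat (int a + c)) \<in> D"
  using box_iff_le_bead[OF assms, of "nat (int a + c)"] by (auto simp: bead_def)

section \<open>Counting boxes along diagonals\<close>

text \<open>
  Up to a constant depending only on \<open>c\<close>, this is the number of boxes of content \<open>c\<close>. So removing
  a rim hook, whose contents form an interval, lowers it by one on that interval.
\<close>

definition height :: "box set \<Rightarrow> int \<Rightarrow> nat" where
  "height D c = card {a. 1 \<le> a \<and> c \<le> bead D a}"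

lemma finite_le_bead:
  assumes "young_diagram D"
  shows "finite {a. 1 \<le> a \<and> c \<le> bead D a}"
proof -
  have "{a. 1 \<le> a \<and> c \<le> bead D a} \<subseteq> fst ` D \<union> {..nat (- c)}"
  proof
    fix a assume "a \<in> {a. 1 \<le> a \<and> c \<le> bead D a}"
    then have "int a + c \<le> 0 \<or> (a, nat (int a + c)) \<in> D" using le_bead_iff[OF assms] by blast
    then show "a \<in> fst ` D \<union> {..nat (- c)}"
      using image_eqI[of a fst "(a, nat (int a + c))" D] by auto
  qed
  moreover have "finite (fst ` D \<union> {..nat (- c)})" using assms by (simp add: young_diagram_def)
  ultimately show ?thesis by (rule finite_subset)
qed

lemma height_step:
  assumes "young_diagram D"
  shows "height D c = height D (c + 1) + of_bool (c \<in> beads D)"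
proof -
  let ?A = "{a. 1 \<le> a \<and> c + 1 \<le> bead D a}" and ?B = "{a. 1 \<le> a \<and> bead D a = c}"
  have split: "{a. 1 \<le> a \<and> c \<le> bead D a} = ?A \<union> ?B" by auto
  have fin: "finite ?B" using finite_le_bead[OF assms, of c] by (rule finite_subset[rotated]) auto
  have "card ?B = of_bool (c \<in> beads D)"
  proof (cases "c \<in> beads D")
    case True
    then obtain a where a: "1 \<le> a" "bead D a = c" by (auto simp: beads_def)
    then have "?B = {a}" using inj_onD[OF inj_on_bead[OF assms]] by auto
    then show ?thesis using True by simp
  next
    case False
    then have "?B = {}" by (auto simp: beads_def)
    then show ?thesis using False by (simp only: card.empty of_bool_eq(1))
  qed
  moreover have "card (?A \<union> ?B) = card ?A + card ?B"
    by (rule card_Un_disjoint[OF finite_le_bead[OF assms] fin]) auto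
  ultimately show ?thesis unfolding height_def split by simp
qed

text \<open>Row \<open>a\<close> stops being counted exactly when its box of content
  \<open>c\<close> lies in \<open>R\<close>. The set \<open>?T\<close> collects these rows, and
  injectivity of \<open>content\<close> leaves at most one.\<close>

lemma height_diff:
  assumes D: "young_diagram D" and E: "young_diagram (D - R)" and R: "R \<subseteq> D"
    and inj: "inj_on content R"
  shows "height D c = height (D - R) c + of_bool (c \<in> content ` R)"
proof -
  let ?T = "fst ` {u \<in> R. content u = c}"
  let ?A = "{a. 1 \<le> a \<and> c \<le> bead (D - R) a}"
  have pos: "1 \<le> a \<and> 1 \<le> b" if "(a, b) \<in> R" for a b
    using young_diagram_pos[OF D] R that by blast
  have T: "a \<in> ?T \<longleftrightarrow> 1 \<le> a \<and> 1 \<le> int a + c \<and> (a, nat (int a + c)) \<in> R" for a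
  proof
    assume "a \<in> ?T"
    then obtain b where b: "(a, b) \<in> R" "content (a, b) = c" by auto
    then have "b = nat (int a + c)" by (simp add: content_def)
    then show "1 \<le> a \<and> 1 \<le> int a + c \<and> (a, nat (int a + c)) \<in> R"
      using b pos[OF b(1)] by (auto simp: content_def)
  next
    assume *: "1 \<le> a \<and> 1 \<le> int a + c \<and> (a, nat (int a + c)) \<in> R"
    then have "content (a, nat (int a + c)) = c" by (simp add: content_def)
    then show "a \<in> ?T" using * by (metis (mono_tags, lifting) fst_conv image_eqI mem_Collect_eq)
  qed
  have split: "{a. 1 \<le> a \<and> c \<le> bead D a} = ?A \<union> ?T"
  proof (rule set_eqI)
    fix a
    show "a \<in> {a. 1 \<le> a \<and> c \<le> bead D a} \<longleftrightarrow> a \<in> ?A \<union> ?T"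
      unfolding Un_iff T mem_Collect_eq
      using le_bead_iff[OF D, of a c] le_bead_iff[OF E, of a c] R by fastforce
  qed
  have disj: "?A \<inter> ?T = {}"
  proof -
    have "False" if "a \<in> ?A" "a \<in> ?T" for a
      using that le_bead_iff[OF E, of a c] unfolding T by auto
    then show ?thesis by blast
  qed
  have fin: "finite R" using D R finite_subset by (auto simp: young_diagram_def)
  have "card ?T = of_bool (c \<in> content ` R)"
  proof (cases "c \<in> content ` R")
    case True
    then obtain u where "u \<in> R" "content u = c" by auto
    then have "{u \<in> R. content u = c} = {u}" using inj_onD[OF inj] by blast
    then show ?thesis using True by simp
  next
    case False
    then have "{u \<in> R. content u = c} = {}" by auto
    then show ?thesis using False by (simp only: image_empty card.empty of_bool_eq(1))
  qed
  moreover have "card (?A \<union> ?T) = card ?A + card ?T"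
    using card_Un_disjoint[OF finite_le_bead[OF E] _ disj] fin by simp
  ultimately show ?thesis unfolding height_def split by simp
qed

text \<open>Beads are the drops of \<open>height\<close>, and passing to \<open>D - R\<close>
  subtracts the indicator function of \<open>{y<..x}\<close> from \<open>height\<close>. That
  function changes only from \<open>y\<close> to \<open>y + 1\<close> and from \<open>x\<close> to
  \<open>x + 1\<close>.\<close>

lemma beads_diff:
  assumes D: "young_diagram D" and E: "young_diagram (D - R)" and R: "R \<subseteq> D"
    and inj: "inj_on content R" and img: "content ` R = {y<..x}" and "y < x"
  shows "x \<in> beads D" "y \<notin> beads D" "beads (D - R) = insert y (beads D - {x})"
proof -
  have *: "of_bool (c \<in> beads D) + of_bool (y < c + 1 \<and> c + 1 \<le> x) =
     (of_bool (c \<in> beads (D - R)) + of_bool (y < c \<and> c \<le> x) :: nat)" for c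
    using height_step[OF D, of c] height_step[OF E, of c]
      height_diff[OF D E R inj, of c] height_diff[OF D E R inj, of "c + 1"] unfolding img by simp
  show x: "x \<in> beads D" using *[of x] \<open>y < x\<close> by (cases "x \<in> beads D") auto
  show y: "y \<notin> beads D" using *[of y] \<open>y < x\<close> by (cases "y \<in> beads (D - R)") auto
  have "c \<in> beads (D - R) \<longleftrightarrow> c \<in> insert y (beads D - {x})" for c
  proof -
    consider "c = x" | "c = y" | "c < y" | "y < c" "c < x" | "x < c" by linarith
    then show ?thesis
      using *[of c] x y \<open>y < x\<close>
      by cases (cases "c \<in> beads (D - R)"; cases "c \<in> beads D"; simp)+
  qed
  then show "beads (D - R) = insert y (beads D - {x})" by blast
qed

section \<open>Shape and contents of a rim hook\<close>

lemma adjacent_content: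
  assumes "adjacent u v"
  shows "content v \<le> content u + 1"
  using assms by (auto simp: adjacent_def content_def)

text \<open>A discrete intermediate value argument: \<open>content\<close> rises by at most one at
  each step of a path in \<open>R\<close>.\<close>

lemma box_connected_content:
  assumes R: "box_connected R" and u: "u \<in> R" "v \<in> R" and c: "content u \<le> c" "c \<le> content v"
  shows "c \<in> content ` R"
proof -
  have "(\<lambda>u v. u \<in> R \<and> v \<in> R \<and> adjacent u v)\<^sup>*\<^sup>* u v" using R u by (auto simp: box_connected_def)
  then show ?thesis using c(2)
  proof (induction rule: rtranclp_induct)
    case base
    then show ?case using c u by force
  next
    case (step v w)
    then have "content w \<le> content v + 1" using adjacent_content by blast
    then show ?case using step by (cases "c \<le> content v") force+
  qed
qed

lemma box_connected_horizontal:
  assumes R: "box_connected R" and no: "\<And>a b. (a, b) \<in> R \<Longrightarrow> (Suc a, b) \<notin> R"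
  shows "horizontal R"
proof (cases "R = {}")
  case False
  then obtain u where u: "u \<in> R" by blast
  have "fst v = fst u" if "v \<in> R" for v
  proof -
    have "(\<lambda>u v. u \<in> R \<and> v \<in> R \<and> adjacent u v)\<^sup>*\<^sup>* u v"
      using R u that by (auto simp: box_connected_def)
    then show ?thesis
    proof (induction rule: rtranclp_induct)
      case (step v w)
      then show ?case using no[of "fst v" "snd v"] no[of "fst w" "snd w"]
        by (auto simp: adjacent_def) (metis prod.collapse)+
    qed simp
  qed
  then show ?thesis by (auto simp: horizontal_def)
qed (simp add: horizontal_def)

text \<open>The corner \<open>(a', b')\<close> forces \<open>(r, s)\<close> into \<open>D\<close>;
  if \<open>(r, s)\<close> survived in \<open>D - R\<close>, so would \<open>(a, b)\<close>.\<close>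

lemma rim_hook_convex:
  assumes D: "young_diagram D" and R: "rim_hook l D R"
    and "(a, b) \<in> R" "(a', b') \<in> R" "a \<le> r" "r \<le> a'" "b \<le> s" "s \<le> b'"
  shows "(r, s) \<in> R"
proof -
  have E: "young_diagram (D - R)" and RD: "R \<subseteq> D" using R by (auto simp: rim_hook_def)
  have "1 \<le> a" "1 \<le> b" using young_diagram_pos[OF D] RD assms(3) by blast+
  then have "(r, s) \<in> D" using young_diagramD[OF D, of a' b' r s] RD assms by auto
  moreover have "(r, s) \<notin> D - R"
    using young_diagramD[OF E, of r s a b] assms \<open>1 \<le> a\<close> \<open>1 \<le> b\<close> by auto
  ultimately show ?thesis by blast
qed

text \<open>Two boxes on one diagonal would, by convexity, enclose a 2 by 2 square.\<close>

lemma rim_hook_inj_on_content: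
  assumes D: "young_diagram D" and R: "rim_hook l D R"
  shows "inj_on content R"
proof -
  have key: "\<not> a < a'" if "(a, b) \<in> R" "(a', b') \<in> R" "content (a, b) = content (a', b')" for a b a' b'
  proof
    assume "a < a'"
    then have "b < b'" using that(3) by (simp add: content_def)
    then have "{(a, b), (a, Suc b), (Suc a, b), (Suc a, Suc b)} \<subseteq> R"
      using rim_hook_convex[OF D R that(1,2)] \<open>a < a'\<close> by auto
    then show False using R unfolding rim_hook_def by blast
  qed
  show ?thesis
  proof (rule inj_onI)
    fix u v assume *: "u \<in> R" "v \<in> R" "content u = content v"
    then have "fst u = fst v" using key[of "fst u" "snd u" "fst v" "snd v"]
        key[of "fst v" "snd v" "fst u" "snd u"] by simp
    then show "u = v" using *(3) by (simp add: content_def prod_eq_iff)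
  qed
qed

text \<open>Connectedness makes the contents an interval, and injectivity gives it \<open>l\<close>
  elements. The half-open form has the moving bead and its target gap as endpoints.\<close>

lemma rim_hook_content:
  assumes D: "young_diagram D" and R: "rim_hook l D R" and l: "0 < l"
  obtains x where "content ` R = {x - int l<..x}"
proof -
  have conn: "box_connected R" and card: "card R = l" using R by (auto simp: rim_hook_def)
  have fin: "finite R" and ne: "R \<noteq> {}" using card l by (auto intro: card_ge_0_finite)
  define m x where "m = Min (content ` R)" and "x = Max (content ` R)"
  have "m \<in> content ` R" "x \<in> content ` R"
    unfolding m_def x_def using fin ne by (auto intro: Min_in Max_in)
  then obtain u v where "u \<in> R" "v \<in> R" "content u = m" "content v = x" by auto
  then have "{m..x} \<subseteq> content ` R" using box_connected_content[OF conn, of u v] by auto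
  moreover have "content ` R \<subseteq> {m..x}" unfolding m_def x_def using fin by auto
  ultimately have img: "content ` R = {m..x}" by blast
  have "card (content ` R) = l" using card_image[OF rim_hook_inj_on_content[OF D R]] card by simp
  then have "m = x - int l + 1" using l unfolding img by simp
  then have "{m..x} = {x - int l<..x}" by auto
  then show thesis using that img by simp
qed

lemma rim_hook_beads:
  assumes D: "young_diagram D" and R: "rim_hook l D R" and l: "0 < l"
    and img: "content ` R = {x - int l<..x}"
  shows "x \<in> beads D" "x - int l \<notin> beads D" "beads (D - R) = insert (x - int l) (beads D - {x})"
  using beads_diff[OF D _ _ rim_hook_inj_on_content[OF D R] img] R l by (auto simp: rim_hook_def)

text \<open>Two vertically adjacent boxes of \<open>R\<close> force into \<open>R\<close> the last
  box of the lower row and the box above it. The content of that last box is a bead, and it lies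
  strictly between \<open>y\<close> and \<open>x\<close>.\<close>

lemma rim_hook_horizontal:
  assumes D: "young_diagram D" and R: "rim_hook l D R"
    and img: "content ` R = {y<..x}" and no: "beads D \<inter> {y<..<x} = {}"
  shows "horizontal R"
proof (rule box_connected_horizontal)
  show "box_connected R" using R by (simp add: rim_hook_def)
next
  fix a b assume ab: "(a, b) \<in> R"
  show "(Suc a, b) \<notin> R"
  proof
    assume S: "(Suc a, b) \<in> R"
    have E: "young_diagram (D - R)" and RD: "R \<subseteq> D" using R by (auto simp: rim_hook_def)
    have pos: "1 \<le> a" "1 \<le> b" using young_diagram_pos[OF D] RD ab by blast+
    define p where "p = part D (Suc a)"
    have p: "(Suc a, b') \<in> D \<longleftrightarrow> 1 \<le> b' \<and> b' \<le> p" for b'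
      using eqset_imp_iff[OF young_diagram_row[OF D, of "Suc a"], of b'] by (simp add: p_def)
    have bp: "b \<le> p" using p[of b] RD S by auto
    have "(Suc a, p) \<in> D" using p[of p] bp pos by simp
    moreover from this have "(a, p) \<in> D"
      using young_diagramD[OF D, of "Suc a" p a p] pos bp by auto
    moreover have "(Suc a, p) \<notin> D - R"
      using young_diagramD[OF E, of "Suc a" p "Suc a" b] S pos bp by auto
    moreover have "(a, p) \<notin> D - R"
      using young_diagramD[OF E, of a p a b] ab pos bp by auto
    ultimately have "content (Suc a, p) \<in> content ` R" "content (a, p) \<in> content ` R" by blast+
    then have "content (Suc a, p) \<in> {y<..<x}" unfolding img by (auto simp: content_def)
    moreover have "content (Suc a, p) \<in> beads D"
      unfolding beads_def by (rule image_eqI[of _ _ "Suc a"]) (auto simp: bead_def p_def content_def)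
    ultimately show False using no by blast
  qed
qed

text \<open>The hook is the stretch of the rim with contents in \<open>{x - int l<..x}\<close>. The
  bead at its upper end and the gap at its lower end ensure that removing it leaves a
  diagram.\<close>

lemma rim_hook_exists:
  assumes D: "young_diagram D" and x: "x \<in> beads D" and y: "x - int l \<notin> beads D"
  obtains R where "rim_hook l D R" "content ` R = {x - int l<..x}"
    "horizontal R \<Longrightarrow> beads D \<inter> {x - int l<..<x} = {}"
proof -
  define y where "y = x - int l"
  have yB: "y \<notin> beads D" using y by (simp add: y_def)
  obtain rx where rx: "1 \<le> rx" "bead D rx = x" using x by (auto simp: beads_def)
  define R where "R = {u \<in> D. (Suc (fst u), Suc (snd u)) \<notin> D \<and> y < content u \<and> content u \<le> x}"
  have R: "(a, b) \<in> R \<longleftrightarrow> (a, b) \<in> D \<and> (Suc a, Suc b) \<notin> D \<and> y < int b - int a \<and> int b - int a \<le> x"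
    for a b by (simp add: R_def content_def)
  have pos: "1 \<le> a \<and> 1 \<le> b" if "(a, b) \<in> D" for a b using young_diagram_pos[OF D that] by simp
  have dn: "(a', b') \<in> D" if "(a, b) \<in> D" "a' \<le> a" "b' \<le> b" "1 \<le> a'" "1 \<le> b'" for a b a' b'
    using young_diagramD[OF D that(1)] that by auto
  have fin: "finite D" using D by (simp add: young_diagram_def)
  have inj: "inj_on content R"
  proof -
    have key: "\<not> a < a'" if "(a, b) \<in> R" "(a', b') \<in> R" "content (a, b) = content (a', b')"
      for a b a' b'
    proof
      assume "a < a'"
      then have "b < b'" using that(3) by (simp add: content_def)
      moreover have "(a', b') \<in> D" "(Suc a, Suc b) \<notin> D" using that(1,2) by (simp_all add: R)
      ultimately show False using dn[of a' b' "Suc a" "Suc b"] \<open>a < a'\<close> by simp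
    qed
    show ?thesis
    proof (rule inj_onI)
      fix u v assume *: "u \<in> R" "v \<in> R" "content u = content v"
      then have "fst u = fst v" using key[of "fst u" "snd u" "fst v" "snd v"]
          key[of "fst v" "snd v" "fst u" "snd u"] by simp
      then show "u = v" using *(3) by (simp add: content_def prod_eq_iff)
    qed
  qed
  \<comment> \<open>Every diagonal in the range meets \<open>D\<close>: for \<open>c \<ge> 0\<close>
    in row 1, whose bead is at least \<open>x\<close>; for \<open>c < 0\<close> in column 1, since
    row \<open>- y\<close> would have bead \<open>y\<close> if it were empty.\<close>
  have ex: "\<exists>a b. (a, b) \<in> D \<and> int b - int a = c" if c: "y < c" "c \<le> x" for c
  proof (cases "0 \<le> c")
    case True
    have "c \<le> bead D 1" using bead_less[OF D, of 1 rx] rx c by (cases "rx = 1") auto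
    then have "(1, nat (1 + c)) \<in> D" using le_bead_iff[OF D, of 1 c] True by simp
    then show ?thesis using True by (intro exI[of _ 1] exI[of _ "nat (1 + c)"]) simp
  next
    case False
    define m where "m = nat (- y)"
    have m: "1 \<le> m" "int m = - y" using False c by (auto simp: m_def)
    have "bead D m \<noteq> y" using yB m by (auto simp: beads_def)
    then have "part D m \<noteq> 0" using m by (simp add: bead_def)
    then have "(m, 1) \<in> D" using eqset_imp_iff[OF young_diagram_row[OF D m(1)], of 1] by simp
    moreover have "nat (1 - c) \<le> m" "1 \<le> nat (1 - c)" using False c m by linarith+
    ultimately have "(nat (1 - c), 1) \<in> D" using dn[of m 1 "nat (1 - c)" 1] by simp
    then show ?thesis using False by (intro exI[of _ "nat (1 - c)"] exI[of _ 1]) simp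
  qed
  have img: "content ` R = {y<..x}"
  proof
    show "content ` R \<subseteq> {y<..x}" by (auto simp: R_def)
    show "{y<..x} \<subseteq> content ` R"
    proof
      fix c assume c: "c \<in> {y<..x}"
      \<comment> \<open>The lowest box of \<open>D\<close> on the diagonal has no diagonal successor
        in \<open>D\<close>, so it lies in \<open>R\<close>.\<close>
      let ?S = "{a. \<exists>b. (a, b) \<in> D \<and> int b - int a = c}"
      have "?S \<subseteq> fst ` D" by force
      then have finS: "finite ?S" using fin finite_subset by blast
      moreover have "?S \<noteq> {}" using ex[of c] c by auto
      ultimately have "Max ?S \<in> ?S" by (rule Max_in)
      then obtain b where b: "(Max ?S, b) \<in> D" "int b - int (Max ?S) = c" by auto
      have "(Suc (Max ?S), Suc b) \<notin> D"
      proof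
        assume "(Suc (Max ?S), Suc b) \<in> D"
        then have "Suc (Max ?S) \<in> ?S" using b(2) by force
        then show False using Max_ge[OF finS, of "Suc (Max ?S)"] by simp
      qed
      then have "(Max ?S, b) \<in> R" using b c by (auto simp: R)
      then show "c \<in> content ` R" using b(2) by (force simp: content_def)
    qed
  qed
  have next_adj: "adjacent u v" if u: "u \<in> R" and v: "v \<in> R" and uv: "content v = content u + 1" for u v
  proof -
    obtain a b where ab: "u = (a, b)" by fastforce
    obtain a' b' where ab': "v = (a', b')" by fastforce
    have uD: "(a, b) \<in> D" "(Suc a, Suc b) \<notin> D" using u by (auto simp: ab R)
    have vD: "(a', b') \<in> D" using v by (auto simp: ab' R)
    have vc: "y < content v" "content v \<le> x" using v by (auto simp: R_def)
    show ?thesis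
    \<comment> \<open>The rim continues to the right if that box is in \<open>D\<close>, and upwards
      otherwise. Injectivity of \<open>content\<close> identifies the box so reached with
      \<open>v\<close>.\<close>
    proof (cases "(a, Suc b) \<in> D")
      case True
      have "(Suc a, Suc (Suc b)) \<notin> D"
        using dn[of "Suc a" "Suc (Suc b)" "Suc a" "Suc b"] uD by auto
      then have "(a, Suc b) \<in> R" using True vc uv by (simp add: R_def ab content_def)
      moreover have "content (a, Suc b) = content v" using uv by (simp add: ab content_def)
      ultimately have "v = (a, Suc b)" using inj_onD[OF inj] v by metis
      then show ?thesis by (simp add: ab adjacent_def)
    next
      case False
      have eq: "int b' - int a' = int b - int a + 1" using uv by (simp add: ab ab' content_def)
      have "a' < a"
      proof (rule ccontr)
        assume "\<not> a' < a"
        then have "(a, Suc b) \<in> D" using eq pos[OF uD(1)] by (intro dn[OF vD]) auto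
        then show False using False by simp
      qed
      then obtain k where k: "a = Suc k" "1 \<le> k" using pos[OF vD] by (cases a) auto
      have "(k, b) \<in> D" using k pos[OF uD(1)] by (intro dn[OF uD(1)]) auto
      moreover have "(Suc k, Suc b) \<notin> D" using False k by simp
      ultimately have "(k, b) \<in> R" using vc uv k by (simp add: R_def ab content_def)
      moreover have "content (k, b) = content v" using uv k by (simp add: ab content_def)
      ultimately have "v = (k, b)" using inj_onD[OF inj] v by metis
      then show ?thesis using k by (simp add: ab adjacent_def)
    qed
  qed
  have sym: "adjacent u v \<longleftrightarrow> adjacent v u" for u v by (auto simp: adjacent_def)
  define r where "r = (\<lambda>u v. u \<in> R \<and> v \<in> R \<and> adjacent u v)"
  have chain: "r\<^sup>*\<^sup>* u v \<and> r\<^sup>*\<^sup>* v u" if "u \<in> R" "v \<in> R" "content v = content u + int n" for u v n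
    using that
  proof (induction n arbitrary: v)
    case 0
    then have "u = v" by (intro inj_onD[OF inj]) auto
    then show ?case by simp
  next
    case (Suc n)
    have "content u + int n \<in> content ` R"
      using imageI[OF Suc.prems(1), of content] imageI[OF Suc.prems(2), of content] Suc.prems(3)
      unfolding img by auto
    then obtain w where w: "w \<in> R" "content w = content u + int n" by auto
    then have "adjacent w v" using Suc.prems next_adj[of w v] by simp
    then have "r w v" "r v w" using w Suc.prems sym by (auto simp: r_def)
    then show ?case using Suc.IH[OF Suc.prems(1) w]
      by (meson converse_rtranclp_into_rtranclp rtranclp.rtrancl_into_rtrancl)
  qed
  have conn: "box_connected R"
    unfolding box_connected_def r_def[symmetric]
  proof (intro ballI)
    fix u v assume uv: "u \<in> R" "v \<in> R"
    show "r\<^sup>*\<^sup>* u v"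
    proof (cases "content u \<le> content v")
      case True
      then show ?thesis using chain[OF uv, of "nat (content v - content u)"] by simp
    next
      case False
      then show ?thesis using chain[OF uv(2,1), of "nat (content u - content v)"] by simp
    qed
  qed
  have "card R = card {y<..x}" using card_image[OF inj] img by simp
  then have card: "card R = l" by (simp add: y_def)
  have sq: "\<not> (\<exists>a b. {(a, b), (a, Suc b), (Suc a, b), (Suc a, Suc b)} \<subseteq> R)" by (auto simp: R)
  \<comment> \<open>This is why \<open>D - R\<close> is a diagram: no box of \<open>D\<close>
    outside \<open>R\<close> has a box of \<open>R\<close> weakly above and to the left of
    it.\<close>
  have notR: "(a', b') \<notin> R"
    if ab: "(a, b) \<in> D" "(a, b) \<notin> R" and le: "1 \<le> a'" "a' \<le> a" "1 \<le> b'" "b' \<le> b" for a b a' b'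
  proof
    assume R': "(a', b') \<in> R"
    then have S': "(Suc a', Suc b') \<notin> D" and c': "y < int b' - int a'" "int b' - int a' \<le> x"
      by (auto simp: R)
    then have "a' = a \<or> b' = b" using dn[OF ab(1), of "Suc a'" "Suc b'"] le by linarith
    then show False
    proof
      assume [simp]: "a' = a"
      have "(Suc a, Suc b) \<notin> D" using dn[of "Suc a" "Suc b" "Suc a" "Suc b'"] S' le by auto
      \<comment> \<open>The row of \<open>(a, b)\<close> reaches beyond content \<open>x\<close>, so
        it lies above row \<open>rx\<close>. Row \<open>Suc a\<close> then still reaches content
        \<open>x\<close> and contains the diagonal successor of \<open>(a, b')\<close>.\<close>
      then have "x < int b - int a" using ab c' le by (auto simp: R)
      then have "x < bead D a" using box_iff_le_bead[OF D, of a b] ab le by auto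
      then have "a < rx" using bead_less_iff[OF D, of a rx] rx le by simp
      then have "x \<le> bead D (Suc a)" using bead_less[OF D, of "Suc a" rx] rx by (cases "Suc a = rx") auto
      then have "(Suc a, Suc b') \<in> D" using box_iff_le_bead[OF D, of "Suc a" "Suc b'"] c' by simp
      then show False using S' by simp
    next
      assume [simp]: "b' = b"
      have "(Suc a, Suc b) \<notin> D" using dn[of "Suc a" "Suc b" "Suc a'" "Suc b"] S' le by auto
      then have cy: "int b - int a \<le> y" using ab c' le by (auto simp: R)
      \<comment> \<open>Column \<open>b\<close> has content \<open>y\<close> in row
        \<open>r\<close>. That row turns out to end there, which would make the gap \<open>y\<close>
        a bead.\<close>
      define r where "r = nat (int b - y)"
      have r: "int r = int b - y" using cy c' by (simp add: r_def)
      then have ra: "a' < r" "r \<le> a" using cy c' by auto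
      then have "(r, b) \<in> D" using le by (intro dn[OF ab(1)]) auto
      moreover have "(r, Suc b) \<notin> D" using dn[of r "Suc b" "Suc a'" "Suc b"] S' ra by auto
      ultimately have "bead D r = y"
        using box_iff_le_bead[OF D, of r b] box_iff_le_bead[OF D, of r "Suc b"] r ra le by auto
      then show False using yB ra by (auto simp: beads_def)
    qed
  qed
  have "young_diagram (D - R)"
    unfolding young_diagram_def
  proof (intro conjI ballI, goal_cases)
    case 1
    show ?case using fin by simp
  next
    case (2 u)
    obtain a b where u: "u = (a, b)" by fastforce
    show ?case using 2 pos[of a b] dn[of a b] notR[of a b] unfolding u by auto
  qed
  then have rim: "rim_hook l D R" using card conn sq by (auto simp: rim_hook_def R_def)
  have "beads D \<inter> {y<..<x} = {}" if hor: "horizontal R"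
  proof (rule ccontr)
    assume "beads D \<inter> {y<..<x} \<noteq> {}"
    then obtain c where c: "c \<in> beads D" "y < c" "c < x" by auto
    obtain r where r: "1 \<le> r" "bead D r = c" using c(1) by (auto simp: beads_def)
    obtain a where a: "\<And>u. u \<in> R \<Longrightarrow> fst u = a" using hor by (auto simp: horizontal_def)
    have "c \<in> content ` R" "c + 1 \<in> content ` R" unfolding img using c by auto
    then obtain u v where uv: "u \<in> R" "content u = c" "v \<in> R" "content v = c + 1" by force
    obtain b where b: "u = (a, b)" using a[OF uv(1)] by (metis prod.collapse)
    then have b': "v = (a, Suc b)" using a[OF uv(3)] uv by (simp add: content_def prod_eq_iff)
    have cc: "int b - int a = c" and v: "(a, Suc b) \<in> D" and S: "(Suc a, Suc b) \<notin> D"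
      using uv b b' by (auto simp: content_def R)
    have "1 \<le> a" using pos[OF v] by simp
    \<comment> \<open>Row \<open>a\<close> reaches content \<open>c + 1\<close>, so the row
      \<open>r\<close> with bead \<open>c\<close> lies strictly below it. Hence row
      \<open>Suc a\<close> still reaches content \<open>c\<close>, and so contains the diagonal
      successor of \<open>u\<close>.\<close>
    then have "c < bead D a" using box_iff_le_bead[OF D, of a "Suc b"] v cc by simp
    then have "a < r" using bead_less_iff[OF D \<open>1 \<le> a\<close> r(1)] r by simp
    then have "c \<le> bead D (Suc a)" using bead_less[OF D, of "Suc a" r] r by (cases "Suc a = r") auto
    then have "(Suc a, Suc b) \<in> D" using box_iff_le_bead[OF D, of "Suc a" "Suc b"] cc by simp
    then show False using S by simp
  qed
  then show thesis using that rim img unfolding y_def by blast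
qed

section \<open>The bead condition for \<open>l\<close>-partitions\<close>

text \<open>
  A bead \<open>x\<close> above a gap \<open>y\<close> stands for the box in the row of \<open>x\<close> and the column of \<open>y\<close>, with
  hook length \<open>x - y\<close>. So this is the condition that in each column \<open>l\<close> divides all hook lengths
  or none.
\<close>

definition carter :: "nat \<Rightarrow> int set \<Rightarrow> bool" where
  "carter l B \<longleftrightarrow> (\<forall>y x x'. y \<notin> B \<longrightarrow> x \<in> B \<longrightarrow> x' \<in> B \<longrightarrow> y < x \<longrightarrow> y < x' \<longrightarrow>
     x mod int l = y mod int l \<longrightarrow> x' mod int l = y mod int l)"

lemma carterD:
  assumes "carter l B" "y \<notin> B" "x \<in> B" "x' \<in> B" "y < x" "y < x'" "x mod int l = y mod int l"
  shows "x' mod int l = y mod int l"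
  using assms unfolding carter_def by blast

text \<open>A bead in between would lie above the gap \<open>x - int l\<close>, as \<open>x\<close>
  does, and so be congruent to \<open>x\<close> at a distance less than \<open>l\<close>.\<close>

lemma carter_no_bead_between:
  assumes "carter l B" "x \<in> B" "x - int l \<notin> B" "0 < l"
  shows "B \<inter> {x - int l<..<x} = {}"
proof (rule ccontr)
  assume "B \<inter> {x - int l<..<x} \<noteq> {}"
  then obtain c where c: "c \<in> B" "x - int l < c" "c < x" by auto
  then have "c mod int l = (x - int l) mod int l"
    using carterD[OF assms(1,3,2) c(1)] assms(4) by (simp add: mod_diff_right_eq)
  then have "int l dvd x - c" by (simp add: mod_eq_dvd_iff dvd_diff_commute)
  then show False using c zdvd_imp_le[of "int l" "x - c"] by simp
qed

text \<open>A bead above a gap \<open>z\<close> can be traded for an old bead above \<open>z\<close>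
  on the same runner, with \<open>x\<close> standing in for \<open>x - int l\<close>. The only new
  gap is \<open>x\<close>, and the beads above \<open>x - int l\<close> were all congruent to
  \<open>x\<close> already.\<close>

lemma carter_move:
  assumes C: "carter l B" and x: "x \<in> B" and y: "x - int l \<notin> B" and l: "0 < l"
  shows "carter l (insert (x - int l) (B - {x}))"
  unfolding carter_def
proof (intro allI impI)
  let ?y = "x - int l"
  fix z u v
  assume z: "z \<notin> insert ?y (B - {x})" and u: "u \<in> insert ?y (B - {x})" and v: "v \<in> insert ?y (B - {x})"
    and zu: "z < u" and zv: "z < v" and eq: "u mod int l = z mod int l"
  have xy: "?y mod int l = x mod int l" "?y < x" using l by (simp_all add: mod_diff_right_eq)
  have aboveB: "w mod int l = x mod int l" if "w \<in> B" "?y < w" for w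
    using carterD[OF C y x that(1) xy(2) that(2)] xy(1) by simp
  have lift: "\<exists>w'\<in>B. z < w' \<and> w' mod int l = w mod int l" if "w \<in> insert ?y (B - {x})" "z < w" for w
    using that x xy by (metis Diff_iff insert_iff order_less_trans)
  obtain u' where u': "u' \<in> B" "z < u'" "u' mod int l = u mod int l" using lift[OF u zu] by blast
  obtain v' where v': "v' \<in> B" "z < v'" "v' mod int l = v mod int l" using lift[OF v zv] by blast
  show "v mod int l = z mod int l"
  proof (cases "z = x")
    case True
    then show ?thesis using aboveB[OF v'(1)] v' xy by simp
  next
    case False
    then have "z \<notin> B" using z by simp
    then show ?thesis using carterD[OF C _ u'(1) v'(1) u'(2) v'(2)] u' v' eq by simp
  qed
qed

text \<open>
  Equal parts are consecutive beads. If there are \<open>l\<close> of them directly above a gap, then one has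
  the residue of the gap and the others do not.
\<close>

lemma carter_l_regular:
  assumes D: "young_diagram D" and C: "carter l (beads D)" and l: "2 \<le> l"
  shows "l_regular l D"
  unfolding l_regular_def
proof (rule notI, elim exE conjE)
  fix k :: nat assume k: "0 < k" and card: "l \<le> card {a. part D a = k}"
  let ?S = "{a. part D a = k}"
  have fin: "finite ?S" using card l by (intro card_ge_0_finite) simp
  define M where "M = Max ?S"
  have "?S \<noteq> {}"
  proof
    assume "?S = {}"
    then show False using card l by (simp only: card.empty)
  qed
  then have "M \<in> ?S" unfolding M_def using fin by (intro Max_in)
  then have M: "part D M = k" by simp
  have pos: "1 \<le> a" if "part D a = k" for a
  proof -
    have "{b. (a, b) \<in> D} \<noteq> {}" using that k by (metis card.empty less_irrefl part_def)
    then show ?thesis using young_diagram_pos[OF D] by blast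
  qed
  \<comment> \<open>At least \<open>l\<close> rows, none below row \<open>M\<close>, do not fit into
    the \<open>l - 1\<close> rows ending at \<open>M\<close>.\<close>
  have "\<exists>a\<in>?S. a \<le> M + 1 - l"
  proof (rule ccontr)
    assume no: "\<not> (\<exists>a\<in>?S. a \<le> M + 1 - l)"
    have "?S \<subseteq> {M + 2 - l..M}"
    proof
      fix a assume a: "a \<in> ?S"
      then have "\<not> a \<le> M + 1 - l" using no by blast
      moreover have "a \<le> M" unfolding M_def using fin a by (rule Max_ge)
      ultimately show "a \<in> {M + 2 - l..M}" by simp
    qed
    then have "card ?S \<le> card {M + 2 - l..M}" by (intro card_mono) simp_all
    then show False using card l by simp
  qed
  then obtain a where a: "part D a = k" "a \<le> M + 1 - l" by blast
  define r where "r = M + 1 - l"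
  have r: "a \<le> r" "r < M" "int r = int M + 1 - int l" "1 \<le> r"
    using a l pos[OF a(1)] by (auto simp: r_def)
  have "bead D r \<le> bead D a - int r + int a"
  proof -
    have "part D r \<le> part D a"
    proof (cases "part D r = 0")
      case False
      then have "(r, part D r) \<in> D"
        using eqset_imp_iff[OF young_diagram_row[OF D r(4)], of "part D r"] by simp
      then have "(a, part D r) \<in> D"
        using young_diagramD[OF D, of r "part D r" a "part D r"] r pos[OF a(1)] False by simp
      then show ?thesis using eqset_imp_iff[OF young_diagram_row[OF D pos[OF a(1)]], of "part D r"] by simp
    qed simp
    then show ?thesis by (simp add: bead_def)
  qed
  moreover have "bead D M + int M \<le> bead D r + int r"
  proof -
    have "(M, k) \<in> D" using eqset_imp_iff[OF young_diagram_row[OF D pos[OF M]], of k] k M by simp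
    then have "(r, k) \<in> D" using young_diagramD[OF D, of M k r k] r k by simp
    then show ?thesis using eqset_imp_iff[OF young_diagram_row[OF D r(4)], of k] M by (simp add: bead_def)
  qed
  ultimately have br: "bead D r = int k - int r" using a M by (simp add: bead_def)
  \<comment> \<open>This is the position just below the bead \<open>y + 1\<close> of row
    \<open>M\<close>. The bead of row \<open>r\<close> is \<open>y + int l\<close>.\<close>
  define y where "y = int k - int M - 1"
  have "y \<notin> beads D"
  proof
    assume "y \<in> beads D"
    then obtain s where s: "1 \<le> s" "bead D s = y" by (auto simp: beads_def)
    then have "M < s" using bead_less_iff[OF D pos[OF M] s(1)] M by (simp add: bead_def y_def)
    moreover have "\<not> Suc M < s" using s M k bead_less[OF D, of "Suc M" s]
      bead_less[OF D pos[OF M], of "Suc M"] by (auto simp: bead_def y_def)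
    ultimately have "s = Suc M" by simp
    then have "part D (Suc M) = k" using s by (simp add: bead_def y_def)
    then have "Suc M \<le> M" unfolding M_def using fin by (intro Max_ge) (simp_all)
    then show False by simp
  qed
  moreover have "int k - int M \<in> beads D"
    unfolding beads_def using M pos[OF M] by (auto simp: bead_def intro!: image_eqI[of _ _ M])
  moreover have "y + int l \<in> beads D"
    unfolding beads_def using br r by (auto simp: y_def intro!: image_eqI[of _ _ r])
  ultimately have "(int k - int M) mod int l = y mod int l"
    using carterD[OF C, of y "y + int l" "int k - int M"] l by (simp add: y_def)
  then have "int l dvd 1" by (simp add: mod_eq_dvd_iff y_def)
  then show False using l by simp
qed

lemma remove_horizontal_hook_carter:
  assumes "remove_horizontal_hook l D E" "young_diagram D" "carter l (beads D)" "0 < l"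
  shows "young_diagram E \<and> carter l (beads E)"
proof -
  obtain R where R: "rim_hook l D R" "E = D - R"
    using assms(1) by (auto simp: remove_horizontal_hook_def)
  obtain x where img: "content ` R = {x - int l<..x}" using rim_hook_content[OF assms(2) R(1) assms(4)] .
  have "young_diagram E" using R by (auto simp: rim_hook_def)
  then show ?thesis
    using carter_move[OF assms(3) _ _ assms(4)] rim_hook_beads[OF assms(2) R(1) assms(4) img] R by simp
qed

text \<open>The bead condition is preserved by removing horizontal hooks, and it leaves no bead
  strictly inside a move, so every hook met on the way is horizontal.\<close>

lemma carter_l_partition:
  assumes D: "young_diagram D" and C: "carter l (beads D)" and l: "2 \<le> l"
  shows "l_partition l D"
  unfolding l_partition_def
proof (intro conjI allI impI)
  fix E assume "(remove_horizontal_hook l)\<^sup>*\<^sup>* D E"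
  then have E: "young_diagram E \<and> carter l (beads E)"
    using D C l by (induction rule: rtranclp_induct) (auto dest: remove_horizontal_hook_carter)
  have "horizontal R" if R: "rim_hook l E R" for R
  proof -
    obtain x where img: "content ` R = {x - int l<..x}" using rim_hook_content[OF _ R] E l by auto
    have "beads E \<inter> {x - int l<..<x} = {}"
      using carter_no_bead_between rim_hook_beads[OF _ R _ img] E l by simp
    then show ?thesis using rim_hook_horizontal[OF _ R img] E by blast
  qed
  then show "\<not> (\<exists>R. rim_hook l E R \<and> \<not> horizontal R)" by blast
qed (use D carter_l_regular[OF assms] in simp_all)

section \<open>From \<open>l\<close>-partitions to the bead condition\<close>

lemma bead_above_gap:
  fixes B :: "int set"
  assumes "y \<notin> B" "x \<in> B" "y \<le> x" "x mod int l = y mod int l" "0 < l"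
  obtains z where "y \<le> z" "z + int l \<le> x" "z \<notin> B" "z + int l \<in> B" "z mod int l = y mod int l"
proof -
  have "int l dvd x - y" using assms(4) by (simp add: mod_eq_dvd_iff)
  then obtain k where k: "x = y + int l * k" by (metis add_diff_cancel_left' diff_add_cancel dvdE add.commute)
  have "0 \<le> k" using assms(3,5) k by (simp add: zero_le_mult_iff)
  then obtain n where n: "x = y + int l * int n" using k by (metis nonneg_int_cases)
  \<comment> \<open>Climbing the runner from the gap \<open>y\<close> to the bead \<open>x\<close>,
    stop at the first gap directly followed by a bead.\<close>
  define P where "P = (\<lambda>n. y + int l * int n \<in> B)"
  have "P n" "\<not> P 0" using n assms by (auto simp: P_def)
  then obtain m where m: "m < n" "\<not> P m" "P (Suc m)"
    by (metis less_Suc_eq_le lessI ex_least_nat_less less_le_not_le)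
  show thesis
  proof
    show "y \<le> y + int l * int m" by simp
    have "int l * int (Suc m) \<le> int l * int n" using m(1) by (intro mult_left_mono) simp_all
    then show "y + int l * int m + int l \<le> x" using n by (simp add: algebra_simps)
    show "y + int l * int m \<notin> B" using m by (simp add: P_def)
    show "y + int l * int m + int l \<in> B" using m by (simp add: P_def algebra_simps)
  qed simp
qed

text \<open>This form of the hook condition passes from \<open>D\<close> to the result of removing a
  horizontal hook, which permits induction on the size of the diagram.\<close>

definition hooks_horizontal :: "nat \<Rightarrow> box set \<Rightarrow> bool" where
  "hooks_horizontal l D \<longleftrightarrow>
     (\<forall>E. (remove_horizontal_hook l)\<^sup>*\<^sup>* D E \<longrightarrow> (\<forall>R. rim_hook l E R \<longrightarrow> horizontal R))"

text \<open>Given a violation \<open>y\<close>, \<open>x\<close>, \<open>v\<close>, some bead can be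
  moved down its runner so that \<open>y\<close> still violates the condition, against the induction
  hypothesis for the smaller diagram.\<close>

lemma hooks_horizontal_carter:
  assumes "young_diagram D" "hooks_horizontal l D" "2 \<le> l"
  shows "carter l (beads D)"
  using assms(1,2)
proof (induction "card D" arbitrary: D rule: less_induct)
  case less
  note D = less.prems(1) and H = less.prems(2)
  have l: "0 < l" using assms(3) by simp
  let ?B = "beads D"
  have step: "?B \<inter> {z<..<z + int l} = {} \<and> carter l (insert z (?B - {z + int l}))"
    if z: "z \<notin> ?B" "z + int l \<in> ?B" for z
  proof -
    obtain R where R: "rim_hook l D R" "content ` R = {z<..z + int l}"
      and between: "horizontal R \<Longrightarrow> ?B \<inter> {z<..<z + int l} = {}"
      using rim_hook_exists[OF D z(2), of l] z(1) by (metis add_diff_cancel_right')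
    have hor: "horizontal R" using H R(1) by (auto simp: hooks_horizontal_def)
    then have rem: "remove_horizontal_hook l D (D - R)"
      using R(1) by (auto simp: remove_horizontal_hook_def)
    have "hooks_horizontal l (D - R)"
      using H rem unfolding hooks_horizontal_def by (meson converse_rtranclp_into_rtranclp)
    moreover have "young_diagram (D - R)" "R \<subseteq> D" "card R = l" using R(1) by (auto simp: rim_hook_def)
    moreover from this have "card (D - R) < card D"
      using D l card_gt_0_iff[of R] card_gt_0_iff[of D] card_mono[of D R]
      by (simp add: card_Diff_subset young_diagram_def)
    ultimately have "carter l (beads (D - R))" using less.hyps by blast
    then show ?thesis using rim_hook_beads(3)[OF D R(1) l, of "z + int l"] R(2) between[OF hor] by simp
  qed
  show ?case
    unfolding carter_def
  proof (intro allI impI, rule ccontr)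
    fix y x v
    assume y: "y \<notin> ?B" and x: "x \<in> ?B" and v: "v \<in> ?B" and yx: "y < x" and yv: "y < v"
      and eq: "x mod int l = y mod int l" and ne: "v mod int l \<noteq> y mod int l"
    show False
    proof (cases "\<exists>w. w \<notin> ?B \<and> y \<le> w \<and> w \<le> v \<and> w mod int l = v mod int l")
      \<comment> \<open>A bead on the runner of \<open>v\<close> moves down to a position
        \<open>z\<close> still above \<open>y\<close>. Then \<open>y\<close>, \<open>x\<close> and
        \<open>z\<close> form a violation.\<close>
      case True
      then obtain w where "w \<notin> ?B" "y \<le> w" "w \<le> v" "w mod int l = v mod int l" by blast
      then obtain z where z: "w \<le> z" "z \<notin> ?B" "z + int l \<in> ?B" "z mod int l = w mod int l"
        using bead_above_gap[OF _ v _ _ l, of w] by metis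
      have zv: "z mod int l = v mod int l" using z(4) \<open>w mod int l = v mod int l\<close> by simp
      have "y \<noteq> z" using zv ne by auto
      then have "y < z" using z(1) \<open>y \<le> w\<close> by simp
      moreover have "x \<noteq> z + int l" using zv eq ne by auto
      ultimately have "z mod int l = y mod int l"
        using carterD[OF conjunct2[OF step[OF z(2,3)]], of y x z] y x yx eq \<open>y \<noteq> z\<close> by simp
      then show False using zv ne by simp
    next
      case False
      obtain z where z: "y \<le> z" "z + int l \<le> x" "z \<notin> ?B" "z + int l \<in> ?B" "z mod int l = y mod int l"
        using bead_above_gap[OF y x _ eq l] yx by auto
      \<comment> \<open>The runner of \<open>v\<close> passes between \<open>z\<close> and
        \<open>z + int l\<close> exactly at \<open>p\<close>, which is a gap by \<open>step\<close>.
        That runner has only beads from \<open>y\<close> to \<open>v\<close>, so \<open>v\<close>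
        lies below \<open>p\<close>, and hence below \<open>z\<close>; after the move
        \<open>y\<close>, \<open>z\<close>, \<open>v\<close> form a violation.\<close>
      define p where "p = z + (v - z) mod int l"
      have pv: "p mod int l = v mod int l" unfolding p_def by (simp add: mod_add_right_eq)
      have "(v - z) mod int l \<noteq> 0" using ne z(5) by (metis mod_eq_dvd_iff mod_0_imp_dvd)
      moreover have "0 \<le> (v - z) mod int l" "(v - z) mod int l < int l" using l by simp_all
      ultimately have p: "z < p" "p < z + int l" by (simp_all add: p_def)
      then have "p \<notin> ?B" using step[OF z(3,4)] by auto
      have "v < p"
      proof (rule ccontr)
        assume "\<not> v < p"
        then have "p \<notin> ?B \<and> y \<le> p \<and> p \<le> v \<and> p mod int l = v mod int l"
          using \<open>p \<notin> ?B\<close> p z(1) pv by simp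
        then show False using False by blast
      qed
      then have "int l \<le> p - v" using pv zdvd_imp_le[of "int l" "p - v"] by (simp add: mod_eq_dvd_iff)
      then have "v < z" using p by simp
      then have "v mod int l = y mod int l"
        using carterD[OF conjunct2[OF step[OF z(3,4)]], of y z v] y v yv z by auto
      then show False using ne by simp
    qed
  qed
qed

lemma l_partition_iff_carter:
  assumes "2 \<le> l"
  shows "l_partition l D \<longleftrightarrow> young_diagram D \<and> carter l (beads D)"
proof
  assume "l_partition l D"
  then show "young_diagram D \<and> carter l (beads D)"
    using hooks_horizontal_carter[OF _ _ assms] by (auto simp: l_partition_def hooks_horizontal_def)
qed (use carter_l_partition[OF _ _ assms] in blast)

section \<open>Signatures and crystal operators on beads\<close>

definition plus_contents :: "nat \<Rightarrow> int \<Rightarrow> int set \<Rightarrow> int set" where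
  "plus_contents l i B = {c. c mod int l = i \<and> c - 1 \<in> B \<and> c \<notin> B}"

definition minus_contents :: "nat \<Rightarrow> int \<Rightarrow> int set \<Rightarrow> int set" where
  "minus_contents l i B = {c. c mod int l = i \<and> c - 1 \<notin> B \<and> c \<in> B}"

text \<open>Removable boxes are rim hooks of length one, so the results on bead moves apply to them
  with length 1.\<close>

lemma rim_hook_one_iff: "rim_hook (Suc 0) D R \<longleftrightarrow> (\<exists>x. R = {x} \<and> x \<in> D \<and> young_diagram (D - {x}))"
  by (auto simp: rim_hook_def box_connected_def card_1_singleton_iff)

lemma removable_beads:
  assumes D: "young_diagram D" and x: "removable l i D x"
  shows "content x \<in> minus_contents l i (beads D)"
    "beads (D - {x}) = insert (content x - 1) (beads D - {content x})"
proof -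
  have R: "rim_hook 1 D {x}" using x by (simp add: rim_hook_one_iff removable_def)
  have img: "content ` {x} = {content x - int 1<..content x}" by auto
  show "content x \<in> minus_contents l i (beads D)"
    "beads (D - {x}) = insert (content x - 1) (beads D - {content x})"
    using rim_hook_beads[OF D R _ img] x
    by (simp_all add: minus_contents_def removable_def residue_def)
qed

lemma addable_beads:
  assumes D: "young_diagram D" and x: "addable l i D x"
  shows "content x \<in> plus_contents l i (beads D)"
    "beads (insert x D) = insert (content x) (beads D - {content x - 1})"
proof -
  have D': "young_diagram (insert x D)" and xD: "x \<notin> D" using x by (auto simp: addable_def)
  have "removable l i (insert x D) x" using D x by (auto simp: removable_def addable_def)
  from removable_beads[OF D' this]
  have *: "content x \<in> minus_contents l i (beads (insert x D))"
    "beads D = insert (content x - 1) (beads (insert x D) - {content x})" using xD by simp_all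
  then show "content x \<in> plus_contents l i (beads D)"
    "beads (insert x D) = insert (content x) (beads D - {content x - 1})"
    by (auto simp: plus_contents_def minus_contents_def)
qed

lemma content_image_removable:
  assumes D: "young_diagram D"
  shows "content ` {x. removable l i D x} = minus_contents l i (beads D)"
proof
  show "content ` {x. removable l i D x} \<subseteq> minus_contents l i (beads D)"
    using removable_beads(1)[OF D] by blast
  show "minus_contents l i (beads D) \<subseteq> content ` {x. removable l i D x}"
  proof
    fix c assume c: "c \<in> minus_contents l i (beads D)"
    then have "c \<in> beads D" "c - int 1 \<notin> beads D" by (simp_all add: minus_contents_def)
    then obtain R where R: "rim_hook 1 D R" "content ` R = {c - int 1<..c}"
      using rim_hook_exists[OF D] by metis
    obtain x where x: "R = {x}" "x \<in> D" "young_diagram (D - {x})"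
      using R(1) by (auto simp: rim_hook_one_iff)
    have "content x \<in> {c - int 1<..c}" using R(2) x(1) by blast
    then have "content x = c" by simp
    then show "c \<in> content ` {x. removable l i D x}"
      using x c by (auto simp: removable_def residue_def minus_contents_def)
  qed
qed

lemma content_image_addable:
  assumes D: "young_diagram D"
  shows "content ` {x. addable l i D x} = plus_contents l i (beads D)"
proof
  show "content ` {x. addable l i D x} \<subseteq> plus_contents l i (beads D)"
    using addable_beads(1)[OF D] by blast
  show "plus_contents l i (beads D) \<subseteq> content ` {x. addable l i D x}"
  proof
    fix c assume "c \<in> plus_contents l i (beads D)"
    then have c: "c mod int l = i" "c - 1 \<in> beads D" "c \<notin> beads D" by (simp_all add: plus_contents_def)
    obtain a where a: "1 \<le> a" "bead D a = c - 1" using c(2) by (auto simp: beads_def)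
    define b where "b = Suc (part D a)"
    have b: "int b = int a + c" using a by (simp add: b_def bead_def)
    have new: "(a, b) \<notin> D" using box_iff_le_bead[OF D a(1), of b] a b by simp
    have left: "(a, b') \<in> D" if "1 \<le> b'" "b' < b" for b'
      using box_iff_le_bead[OF D a(1), of b'] a b that by simp
    have "(a', b) \<in> D" if "1 \<le> a'" "a' < a" for a'
    proof -
      \<comment> \<open>As \<open>c\<close> is a gap, the bead of the row above is at least
        \<open>c + 1\<close>, so that row is strictly longer than row \<open>a\<close>.\<close>
      have "bead D (a - 1) \<noteq> c" using c(3) that by (auto simp: beads_def)
      moreover have "c - 1 < bead D (a - 1)" using bead_less[OF D, of "a - 1" a] that a by simp
      ultimately have "(a - 1, b) \<in> D"
        using box_iff_le_bead[OF D, of "a - 1" b] that b by (simp add: b_def of_nat_diff)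
      then show ?thesis using young_diagramD[OF D, of "a - 1" b a' b] that by (simp add: b_def)
    qed
    note above = this
    have rect: "(a', b') \<in> insert (a, b) D" if "1 \<le> a'" "a' \<le> a" "1 \<le> b'" "b' \<le> b" for a' b'
    proof (cases "a' = a")
      case True
      then show ?thesis using left[of b'] that by (cases "b' = b") auto
    next
      case False
      then have "(a', b) \<in> D" using above[of a'] that by simp
      then show ?thesis using young_diagramD[OF D, of a' b a' b'] that by simp
    qed
    have "young_diagram (insert (a, b) D)"
      unfolding young_diagram_def
    proof (intro conjI ballI, goal_cases)
      case 1
      show ?case using D by (simp add: young_diagram_def)
    next
      case (2 u)
      obtain a' b' where u: "u = (a', b')" by fastforce
      show ?case
      proof (cases "u = (a, b)")
        case True
        then show ?thesis using rect a(1) by (simp add: b_def)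
      next
        case False
        then have "(a', b') \<in> D" using 2 u by auto
        then show ?thesis
          using young_diagram_pos[OF D, of a' b'] young_diagramD[OF D, of a' b'] by (simp add: u)
      qed
    qed
    moreover have "content (a, b) = c" using b by (simp add: content_def)
    ultimately have "addable l i D (a, b)" using new c by (simp add: addable_def residue_def)
    then show "c \<in> content ` {x. addable l i D x}" using \<open>content (a, b) = c\<close> by force
  qed
qed

section \<open>Signatures without cancellation\<close>

definition separated :: "nat \<Rightarrow> int \<Rightarrow> int set \<Rightarrow> bool" where
  "separated l i B \<longleftrightarrow> (\<forall>c\<in>minus_contents l i B. \<forall>d\<in>plus_contents l i B. d < c)"

text \<open>The signature is sorted by content, so a pair \<open>-+\<close> would be a removable box
  of smaller content than an addable one.\<close>

lemma separated_reduced_signature: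
  assumes D: "young_diagram D" and S: "separated l i (beads D)"
  shows "reduced_signature l i D = signature l i D"
  unfolding reduced_signature_eq
proof (rule reduce_irreducible, rule notI)
  assume "\<exists>w'. cancel (signature l i D) w'"
  then obtain u v x y where "signature l i D = u @ (Minus, x) # (Plus, y) # v"
    by (auto elim: cancel.cases)
  then obtain u' x' y' v' where
    xs: "sorted_key_list_of_set content (signature_boxes l i D) = u' @ x' # y' # v'"
    and x: "(if removable l i D x' then Minus else Plus, x') = (Minus, x)"
    and y: "(if removable l i D y' then Minus else Plus, y') = (Plus, y)"
    unfolding signature_def by (auto simp: map_eq_append_conv map_eq_Cons_conv)
  have "content x' < content y'"
    using signature_boxes_list(2)[OF D, of l i] unfolding xs by (simp add: sorted_wrt_append)
  moreover have "y' \<in> signature_boxes l i D"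
    using signature_boxes_list(1)[OF D, of l i] unfolding xs by auto
  then have "addable l i D y'" using y by (auto simp: signature_boxes_def split: if_splits)
  moreover have "removable l i D x'" using x by (auto split: if_splits)
  ultimately have "content y' < content x'"
    using S removable_beads(1)[OF D, of l i x'] addable_beads(1)[OF D, of l i y']
    by (simp add: separated_def)
  then show False using \<open>content x' < content y'\<close> by simp
qed

lemma sorted_wrt_map_filter:
  "sorted_wrt R (map f xs) \<Longrightarrow> sorted_wrt R (map f (filter P xs))"
  by (induction xs) auto

lemma separated_boxes:
  assumes D: "young_diagram D" and S: "separated l i (beads D)"
  shows "set (normal_boxes l i D) = {x. removable l i D x}"
    "set (conormal_boxes l i D) = {x. addable l i D x}"
    "sorted_wrt (<) (map content (normal_boxes l i D))"
    "sorted_wrt (<) (map content (conormal_boxes l i D))"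
proof -
  let ?xs = "sorted_key_list_of_set content (signature_boxes l i D)"
  note xs = signature_boxes_list[OF D, of l i]
  have "normal_boxes l i D = filter (removable l i D) ?xs"
    "conormal_boxes l i D = filter (\<lambda>x. \<not> removable l i D x) ?xs"
    unfolding normal_boxes_def conormal_boxes_def separated_reduced_signature[OF assms] signature_def
    by (simp_all add: filter_map comp_def)
  then show "set (normal_boxes l i D) = {x. removable l i D x}"
    "set (conormal_boxes l i D) = {x. addable l i D x}"
    "sorted_wrt (<) (map content (normal_boxes l i D))"
    "sorted_wrt (<) (map content (conormal_boxes l i D))"
    using xs by (auto intro: sorted_wrt_map_filter simp: signature_boxes_def removable_def addable_def)
qed

lemma length_sorted_map:
  fixes f :: "'a \<Rightarrow> 'b :: linorder"
  assumes "sorted_wrt (<) (map f xs)"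
  shows "length xs = card (f ` set xs)"
  using distinct_card[of "map f xs"] assms by (simp add: strict_sorted_iff)

lemma separated_phi_epsilon:
  assumes D: "young_diagram D" and S: "separated l i (beads D)"
  shows "phi l i D = card (plus_contents l i (beads D))"
    "epsilon l i D = card (minus_contents l i (beads D))"
    "finite (plus_contents l i (beads D))" "finite (minus_contents l i (beads D))"
  using length_sorted_map[OF separated_boxes(3)[OF assms]] length_sorted_map[OF separated_boxes(4)[OF assms]]
    separated_boxes(1,2)[OF assms] content_image_removable[OF D, of l i] content_image_addable[OF D, of l i]
  unfolding phi_def epsilon_def by (metis, metis, metis List.finite_set finite_imageI, metis List.finite_set finite_imageI)

lemma last_sorted_map:
  fixes f :: "'a \<Rightarrow> 'b :: linorder"
  assumes "sorted_wrt (<) (map f xs)" "x \<in> set xs"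
  shows "f x \<le> f (last xs)"
  using assms by (induction xs) (auto simp: less_imp_le)

lemma hd_sorted_map:
  fixes f :: "'a \<Rightarrow> 'b :: linorder"
  assumes "sorted_wrt (<) (map f xs)" "x \<in> set xs"
  shows "f (hd xs) \<le> f x"
  using assms by (cases xs) (auto simp: less_imp_le)

section \<open>Adding or removing all \<open>i\<close>-boxes\<close>

text \<open>In each pair \<open>c - 1\<close>, \<open>c\<close> with \<open>c\<close> on runner
  \<open>i\<close>, a lone bead is pushed to \<open>c\<close>: afterwards \<open>c\<close> is a bead
  iff one of the two was, and \<open>c - 1\<close> iff both were. This closed form is unchanged by a
  single addition, so it serves as an invariant; \<open>swap_minus\<close> pushes lone beads the
  other way.\<close>

definition swap_plus :: "nat \<Rightarrow> int \<Rightarrow> int set \<Rightarrow> int set" where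
  "swap_plus l i B = {c. if c mod int l = i then c \<in> B \<or> c - 1 \<in> B
     else if (c + 1) mod int l = i then c \<in> B \<and> c + 1 \<in> B else c \<in> B}"

definition swap_minus :: "nat \<Rightarrow> int \<Rightarrow> int set \<Rightarrow> int set" where
  "swap_minus l i B = {c. if c mod int l = i then c \<in> B \<and> c - 1 \<in> B
     else if (c + 1) mod int l = i then c \<in> B \<or> c + 1 \<in> B else c \<in> B}"

lemma mod_add_one_neq:
  assumes "2 \<le> l"
  shows "(c + 1) mod int l \<noteq> c mod int l"
proof
  assume "(c + 1) mod int l = c mod int l"
  then have "int l dvd 1" by (simp add: mod_eq_dvd_iff)
  then show False using assms by simp
qed

lemma mod_add_one_cong: "(a + 1) mod int l = (b + 1) mod int l \<longleftrightarrow> a mod int l = b mod int l"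
  by (simp add: mod_eq_dvd_iff)

lemma mod_diff_one_neq:
  assumes "2 \<le> l" "c mod int l = i"
  shows "(c - 1) mod int l \<noteq> i"
  using mod_add_one_neq[OF assms(1), of "c - 1"] assms(2) by simp

text \<open>For \<open>l \<ge> 2\<close> the pairs \<open>c - 1\<close>, \<open>c\<close> with
  \<open>c\<close> on runner \<open>i\<close> are disjoint, so a move affects only its own
  pair.\<close>

lemma move_plus:
  assumes l: "2 \<le> l" and c: "c \<in> plus_contents l i B"
  shows "plus_contents l i (insert c (B - {c - 1})) = plus_contents l i B - {c}"
    "minus_contents l i (insert c (B - {c - 1})) = insert c (minus_contents l i B)"
    "swap_plus l i (insert c (B - {c - 1})) = swap_plus l i B"
proof -
  have i: "c mod int l = i" "(c - 1) mod int l \<noteq> i" "(c + 1) mod int l \<noteq> i"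
    using c mod_diff_one_neq[OF l, of c] mod_add_one_neq[OF l, of c] by (auto simp: plus_contents_def)
  show "plus_contents l i (insert c (B - {c - 1})) = plus_contents l i B - {c}"
    "minus_contents l i (insert c (B - {c - 1})) = insert c (minus_contents l i B)"
    using c i by (auto simp: plus_contents_def minus_contents_def)
  have "d \<in> swap_plus l i (insert c (B - {c - 1})) \<longleftrightarrow> d \<in> swap_plus l i B" for d
  proof -
    consider "d = c" | "d = c - 1" | "d = c + 1" | "d \<noteq> c" "d \<noteq> c - 1" "d \<noteq> c + 1" by blast
    \<comment> \<open>The position \<open>c - 2\<close> also has a neighbour that changes, but it is
      not paired with \<open>c - 1\<close>.\<close>
    moreover have "d + 1 \<noteq> c - 1" if "(d + 1) mod int l = i" using that i(2) by metis
    ultimately show ?thesis using c i by cases (auto simp: plus_contents_def swap_plus_def)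
  qed
  then show "swap_plus l i (insert c (B - {c - 1})) = swap_plus l i B" by blast
qed

lemma move_minus:
  assumes l: "2 \<le> l" and c: "c \<in> minus_contents l i B"
  shows "minus_contents l i (insert (c - 1) (B - {c})) = minus_contents l i B - {c}"
    "plus_contents l i (insert (c - 1) (B - {c})) = insert c (plus_contents l i B)"
    "swap_minus l i (insert (c - 1) (B - {c})) = swap_minus l i B"
proof -
  have i: "c mod int l = i" "(c - 1) mod int l \<noteq> i" "(c + 1) mod int l \<noteq> i"
    using c mod_diff_one_neq[OF l, of c] mod_add_one_neq[OF l, of c] by (auto simp: minus_contents_def)
  show "minus_contents l i (insert (c - 1) (B - {c})) = minus_contents l i B - {c}"
    "plus_contents l i (insert (c - 1) (B - {c})) = insert c (plus_contents l i B)"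
    using c i by (auto simp: plus_contents_def minus_contents_def)
  have "d \<in> swap_minus l i (insert (c - 1) (B - {c})) \<longleftrightarrow> d \<in> swap_minus l i B" for d
  proof -
    consider "d = c" | "d = c - 1" | "d = c + 1" | "d \<noteq> c" "d \<noteq> c - 1" "d \<noteq> c + 1" by blast
    moreover have "d + 1 \<noteq> c - 1" if "(d + 1) mod int l = i" using that i(2) by metis
    ultimately show ?thesis using c i by cases (auto simp: minus_contents_def swap_minus_def)
  qed
  then show "swap_minus l i (insert (c - 1) (B - {c})) = swap_minus l i B" by blast
qed

lemma swap_plus_id:
  assumes "plus_contents l i B = {}"
  shows "swap_plus l i B = B"
proof -
  have *: "c \<in> B" if "c mod int l = i" "c - 1 \<in> B" for c
    using assms that by (auto simp: plus_contents_def)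
  show ?thesis using * *[of "c + 1" for c] by (auto simp: swap_plus_def)
qed

lemma swap_minus_id:
  assumes "minus_contents l i B = {}"
  shows "swap_minus l i B = B"
proof -
  have *: "c - 1 \<in> B" if "c mod int l = i" "c \<in> B" for c
    using assms that by (auto simp: minus_contents_def)
  show ?thesis using * *[of "c + 1" for c] by (auto simp: swap_minus_def)
qed

text \<open>As nothing cancels, the cogood box is the addable box of largest content. Turning its
  \<open>+\<close> into a \<open>-\<close> keeps every \<open>+\<close> before every
  \<open>-\<close>, so the induction continues, and the invariant \<open>swap_plus\<close> gives the
  final bead set.\<close>

lemma f_tilde_funpow:
  assumes "2 \<le> l" "young_diagram D" "separated l i (beads D)" "card (plus_contents l i (beads D)) = n"
  shows "\<exists>E. (f_tilde l i ^^ n) (Some D) = Some E \<and> young_diagram E \<and> beads E = swap_plus l i (beads D)"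
  using assms(2-)
proof (induction n arbitrary: D)
  case 0
  \<comment> \<open>Since \<open>card\<close> is also 0 on infinite sets, finiteness is used to
    conclude that there are no addable boxes.\<close>
  then show ?case using swap_plus_id separated_phi_epsilon(3)[OF 0(1,2)] by auto
next
  case (Suc n)
  note D = Suc.prems(1) and S = Suc.prems(2)
  let ?ys = "conormal_boxes l i D" and ?P = "plus_contents l i (beads D)"
  have img: "content ` set ?ys = ?P"
    using separated_boxes(2)[OF D S] content_image_addable[OF D] by simp
  have ne: "?ys \<noteq> []" using img Suc.prems(3) by auto
  define y where "y = last ?ys"
  have "addable l i D y" using separated_boxes(2)[OF D S] last_in_set[OF ne] by (auto simp: y_def)
  note y = addable_beads[OF D this] and yE = this
  let ?D = "insert y D"
  have max: "d \<le> content y" if "d \<in> ?P" for d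
    using last_sorted_map[OF separated_boxes(4)[OF D S]] that unfolding img[symmetric] y_def by blast
  have D': "young_diagram ?D" using yE by (simp add: addable_def)
  note mv = move_plus[OF assms(1) y(1), folded y(2)]
  have "separated l i (beads ?D)"
    using S max unfolding separated_def mv(1,2) by fastforce
  moreover have "card (plus_contents l i (beads ?D)) = n"
    using Suc.prems(3) y(1) unfolding mv(1) by simp
  ultimately obtain E where "(f_tilde l i ^^ n) (Some ?D) = Some E" "young_diagram E"
    "beads E = swap_plus l i (beads ?D)" using Suc.IH[OF D'] by blast
  moreover have "f_tilde l i (Some D) = Some ?D" using ne by (simp add: y_def)
  ultimately show ?case using mv(3) by (simp add: funpow_Suc_right del: funpow.simps f_tilde.simps)
qed

text \<open>The mirror image: the good box is the removable box of smallest content, and its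
  \<open>-\<close> becomes a \<open>+\<close> before all remaining \<open>-\<close>.\<close>

lemma e_tilde_funpow:
  assumes "2 \<le> l" "young_diagram D" "separated l i (beads D)" "card (minus_contents l i (beads D)) = n"
  shows "\<exists>E. (e_tilde l i ^^ n) (Some D) = Some E \<and> young_diagram E \<and> beads E = swap_minus l i (beads D)"
  using assms(2-)
proof (induction n arbitrary: D)
  case 0
  then show ?case using swap_minus_id separated_phi_epsilon(4)[OF 0(1,2)] by auto
next
  case (Suc n)
  note D = Suc.prems(1) and S = Suc.prems(2)
  let ?ys = "normal_boxes l i D" and ?M = "minus_contents l i (beads D)"
  have img: "content ` set ?ys = ?M"
    using separated_boxes(1)[OF D S] content_image_removable[OF D] by simp
  have ne: "?ys \<noteq> []" using img Suc.prems(3) by auto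
  define y where "y = hd ?ys"
  have "removable l i D y" using separated_boxes(1)[OF D S] hd_in_set[OF ne] by (auto simp: y_def)
  note y = removable_beads[OF D this] and yE = this
  let ?D = "D - {y}"
  have min: "content y \<le> d" if "d \<in> ?M" for d
    using hd_sorted_map[OF separated_boxes(3)[OF D S]] that unfolding img[symmetric] y_def by blast
  have D': "young_diagram ?D" using yE by (simp add: removable_def)
  note mv = move_minus[OF assms(1) y(1), folded y(2)]
  have "separated l i (beads ?D)"
    using S min unfolding separated_def mv(1,2) by fastforce
  moreover have "card (minus_contents l i (beads ?D)) = n"
    using Suc.prems(3) y(1) unfolding mv(1) by simp
  ultimately obtain E where "(e_tilde l i ^^ n) (Some ?D) = Some E" "young_diagram E"
    "beads E = swap_minus l i (beads ?D)" using Suc.IH[OF D'] by blast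
  moreover have "e_tilde l i (Some D) = Some ?D" using ne by (simp add: y_def)
  ultimately show ?case using mv(3) by (simp add: funpow_Suc_right del: funpow.simps e_tilde.simps)
qed

section \<open>The exchange preserves the bead condition\<close>

text \<open>
  A removable box of content \<open>c\<close> and an addable one of content \<open>d > c\<close> would put the beads
  \<open>c\<close> and \<open>d - 1\<close>, of different residues, above the gap \<open>c - 1\<close>.
\<close>

lemma carter_separated:
  assumes C: "carter l B" and l: "2 \<le> l"
  shows "separated l i B"
  unfolding separated_def
proof (intro ballI, rule ccontr)
  fix c d assume c: "c \<in> minus_contents l i B" and d: "d \<in> plus_contents l i B" and "\<not> d < c"
  then have "c < d" by (metis (mono_tags, lifting) linorder_neqE minus_contents_def plus_contents_def mem_Collect_eq)
  moreover have "(d - 1) mod int l = (c - 1) mod int l"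
    using c d mod_add_one_cong[of "d - 1" l "c - 1"] by (simp add: minus_contents_def plus_contents_def)
  ultimately have "c mod int l = (c - 1) mod int l"
    using carterD[OF C, of "c - 1" "d - 1" c] c d by (simp add: minus_contents_def plus_contents_def)
  then show False using mod_add_one_neq[OF l, of "c - 1"] by simp
qed

text \<open>The beads \<open>x - 1\<close> and \<open>x\<close> have different residues, so no gap
  on either of their runners can lie below both.\<close>

lemma carter_no_gap_below_pair:
  assumes C: "carter l B" and l: "2 \<le> l" and x: "x \<in> B" "x - 1 \<in> B"
    and c: "c mod int l = x mod int l" "c < x"
  shows "c \<in> B" "c - 1 \<in> B"
proof -
  have ne: "(x - 1) mod int l \<noteq> x mod int l" using mod_add_one_neq[OF l, of "x - 1"] by simp
  have "int l \<le> x - c"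
    using c zdvd_imp_le[of "int l" "x - c"] by (simp add: mod_eq_dvd_iff dvd_diff_commute)
  then have c2: "c < x - 1" using l by simp
  show "c \<in> B" using carterD[OF C _ x c(2) c2] c(1) ne by auto
  have "(x - 1) mod int l = (c - 1) mod int l"
    using c(1) mod_add_one_cong[of "x - 1" l "c - 1"] by simp
  then show "c - 1 \<in> B" using carterD[OF C _ x(2,1), of "c - 1"] c ne by auto
qed

lemma mod_eq_add_two:
  assumes "(c::int) < x" "x mod int l = c mod int l" "2 \<le> l"
  shows "c + 2 \<le> x"
proof -
  have "int l \<le> x - c" using assms(1,2) zdvd_imp_le[of "int l" "x - c"] by (simp add: mod_eq_dvd_iff)
  then show ?thesis using assms(3) by simp
qed

text \<open>The cases follow the runner of the new gap \<open>y\<close>. On runner \<open>i\<close>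
  the pair \<open>y - 1\<close>, \<open>y\<close> was empty; on runner \<open>i - 1\<close> the bead
  \<open>x\<close> survives only in a full pair, which forces a full pair at \<open>y\<close>;
  elsewhere \<open>x\<close> and \<open>y\<close> have not changed.\<close>

lemma carter_swap_plus:
  assumes C: "carter l B" and l: "2 \<le> l"
  shows "carter l (swap_plus l i B)"
  unfolding carter_def
proof (intro allI impI)
  let ?S = "swap_plus l i B"
  fix y x z
  assume y: "y \<notin> ?S" and x: "x \<in> ?S" and z: "z \<in> ?S" and yx: "y < x" and yz: "y < z"
    and eq: "x mod int l = y mod int l"
  have pred: "(c - 1) mod int l = (d - 1) mod int l \<longleftrightarrow> c mod int l = d mod int l" for c d
    using mod_add_one_cong[of "c - 1" l "d - 1"] by simp
  have ne: "(c - 1) mod int l \<noteq> c mod int l" for c using mod_add_one_neq[OF l, of "c - 1"] by simp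
  note above = carterD[OF C]
  consider (main) "y mod int l = i" | (prev) "y mod int l \<noteq> i" "(y + 1) mod int l = i"
    | (other) "y mod int l \<noteq> i" "(y + 1) mod int l \<noteq> i" by blast
  then show "z mod int l = y mod int l"
  proof cases
    case main
    then have yB: "y \<notin> B" "y - 1 \<notin> B" using y by (auto simp: swap_plus_def)
    show ?thesis
    proof (rule ccontr)
      assume nz: "z mod int l \<noteq> y mod int l"
      then have zB: "z \<in> B" using z main by (auto simp: swap_plus_def split: if_splits)
      have "x \<in> B \<or> x - 1 \<in> B" using x main eq by (simp add: swap_plus_def)
      then show False
      proof
        assume "x \<in> B"
        then show False using above[OF yB(1) _ zB yx yz eq] nz by simp
      next
        assume x1: "x - 1 \<in> B"
        then have zc: "z mod int l = (y - 1) mod int l"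
          using above[OF yB(2) x1 zB] yx yz eq pred by simp
        then have z1: "(z + 1) mod int l = y mod int l"
          using mod_add_one_cong[of z l "y - 1"] by simp
        \<comment> \<open>A bead remains on runner \<open>i - 1\<close> only if its partner is a
          bead too; that partner has the wrong residue above the old gap
          \<open>y - 1\<close>.\<close>
        then have "z + 1 \<in> B" using z nz main by (simp add: swap_plus_def)
        then have "(z + 1) mod int l = (y - 1) mod int l"
          using above[OF yB(2) x1] yx yz eq pred by simp
        then show False using z1 ne[of y] by simp
      qed
    qed
  next
    case prev
    then have xi: "x mod int l \<noteq> i" "(x + 1) mod int l = i"
      using eq mod_add_one_cong[of x l y] by auto
    then have "x \<in> B" "x + 1 \<in> B" using x by (simp_all add: swap_plus_def)
    then have "y + 1 \<in> B" "y + 1 - 1 \<in> B"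
      using carter_no_gap_below_pair[OF C l, of "x + 1" "y + 1"] xi prev yx by simp_all
    then have "y \<in> ?S" using prev by (simp add: swap_plus_def)
    then show ?thesis using y by simp
  next
    case other
    have yB: "y \<notin> B" using y other by (simp add: swap_plus_def)
    have xB: "x \<in> B" using x other eq mod_add_one_cong[of x l y] by (simp add: swap_plus_def)
    show ?thesis
    proof (rule ccontr)
      assume nz: "z mod int l \<noteq> y mod int l"
      have "z \<notin> B" using above[OF yB xB _ yx yz eq] nz by blast
      \<comment> \<open>So \<open>z\<close> is a pushed bead, and its old position
        \<open>z - 1\<close> must be on the runner of \<open>y\<close>.\<close>
      then have z1: "z mod int l = i" "z - 1 \<in> B" using z by (auto simp: swap_plus_def split: if_splits)
      have "y \<noteq> z - 1" using yB z1 by auto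
      then have "(z - 1) mod int l = y mod int l" using above[OF yB xB z1(2) yx _ eq] yz by simp
      then have "(y + 1) mod int l = i" using mod_add_one_cong[of "z - 1" l y] z1 by simp
      then show False using other by simp
    qed
  qed
qed

text \<open>The same argument with the roles of the runners \<open>i\<close> and
  \<open>i - 1\<close> exchanged.\<close>

lemma carter_swap_minus:
  assumes C: "carter l B" and l: "2 \<le> l"
  shows "carter l (swap_minus l i B)"
  unfolding carter_def
proof (intro allI impI)
  let ?S = "swap_minus l i B"
  fix y x z
  assume y: "y \<notin> ?S" and x: "x \<in> ?S" and z: "z \<in> ?S" and yx: "y < x" and yz: "y < z"
    and eq: "x mod int l = y mod int l"
  have ne: "(c - 1) mod int l \<noteq> c mod int l" for c using mod_add_one_neq[OF l, of "c - 1"] by simp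
  note above = carterD[OF C]
  consider (main) "y mod int l = i" | (prev) "y mod int l \<noteq> i" "(y + 1) mod int l = i"
    | (other) "y mod int l \<noteq> i" "(y + 1) mod int l \<noteq> i" by blast
  then show "z mod int l = y mod int l"
  proof cases
    case main
    then have "x \<in> B" "x - 1 \<in> B" using x eq by (simp_all add: swap_minus_def)
    then have "y \<in> B" "y - 1 \<in> B"
      using carter_no_gap_below_pair[OF C l, of x y] eq yx by simp_all
    then have "y \<in> ?S" using main by (simp add: swap_minus_def)
    then show ?thesis using y by simp
  next
    case prev
    then have yB: "y \<notin> B" "y + 1 \<notin> B" using y by (auto simp: swap_minus_def)
    show ?thesis
    proof (rule ccontr)
      assume nz: "z mod int l \<noteq> y mod int l"
      then have nz1: "(z + 1) mod int l \<noteq> i" using prev mod_add_one_cong[of z l y] by auto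
      then have zB: "z \<in> B" using z by (auto simp: swap_minus_def split: if_splits)
      have xi: "x mod int l \<noteq> i" "(x + 1) mod int l = i"
        using eq prev mod_add_one_cong[of x l y] by auto
      then have "x \<in> B \<or> x + 1 \<in> B" using x by (simp add: swap_minus_def)
      then show False
      proof
        assume "x \<in> B"
        then show False using above[OF yB(1) _ zB yx yz eq] nz by simp
      next
        assume x1: "x + 1 \<in> B"
        have "z \<noteq> y + 1" using zB yB by auto
        then have zy: "y + 1 < z" using yz by simp
        have zi: "z mod int l = i"
          using above[OF yB(2) x1 zB] xi prev yx zy by simp
        then have z1: "z - 1 \<in> B" using z by (simp add: swap_minus_def)
        \<comment> \<open>Both \<open>z\<close> and \<open>y + 1\<close> are on runner
          \<open>i\<close>, so they differ by at least \<open>l\<close>; this puts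
          \<open>z - 1\<close> strictly above the gap \<open>y + 1\<close>.\<close>
        have "y + 1 < z - 1" using mod_eq_add_two[OF zy _ l] zi prev by simp
        then have "(z - 1) mod int l = i" using above[OF yB(2) x1 z1] xi prev yx by simp
        then show False using zi ne[of z] by simp
      qed
    qed
  next
    case other
    have yB: "y \<notin> B" using y other by (simp add: swap_minus_def)
    have xB: "x \<in> B" using x other eq mod_add_one_cong[of x l y] by (simp add: swap_minus_def)
    show ?thesis
    proof (rule ccontr)
      assume nz: "z mod int l \<noteq> y mod int l"
      have "z \<notin> B" using above[OF yB xB _ yx yz eq] nz by blast
      then have z1: "(z + 1) mod int l = i" "z + 1 \<in> B"
        using z by (auto simp: swap_minus_def split: if_splits)
      then have "(z + 1) mod int l = y mod int l" using above[OF yB xB z1(2) yx _ eq] yz by simp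
      then show False using other z1 by simp
    qed
  qed
qed

theorem theorem2p4p2p1:
  fixes l :: nat and i :: int and lam :: "box set"
  assumes "l \<ge> 2"
    and "l_partition l lam"
    and "0 \<le> i" and "i < int l"
  shows "(\<exists>mu. (f_tilde l i ^^ phi l i lam) (Some lam) = Some mu \<and> l_partition l mu) \<and>
         (\<exists>mu. (e_tilde l i ^^ epsilon l i lam) (Some lam) = Some mu \<and> l_partition l mu)"
proof -
  have D: "young_diagram lam" and C: "carter l (beads lam)"
    using assms(2) l_partition_iff_carter[OF assms(1)] by blast+
  \<comment> \<open>With nothing cancelling, \<open>phi\<close> and \<open>epsilon\<close> count all
    addable and all removable \<open>i\<close>-boxes, as the exponents in
    \<open>f_tilde_funpow\<close> and \<open>e_tilde_funpow\<close> require.\<close>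
  note S = carter_separated[OF C assms(1), of i]
  show ?thesis
    using f_tilde_funpow[OF assms(1) D S] e_tilde_funpow[OF assms(1) D S] separated_phi_epsilon(1,2)[OF D S]
      carter_swap_plus[OF C assms(1), of i] carter_swap_minus[OF C assms(1), of i]
      l_partition_iff_carter[OF assms(1)] by metis
qed

end
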